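(* Let $(X_k,Y_k)_{k\in\mathbb{N}}$ be an iid sequence of $\mathbb{R}^2$-valued random vectors with the same distribution as a generic vector $(X,Y)$, and let $m=m(n)$ be integers with $m<n$ and $m\to\infty$ as $n\to\infty$. Let $T_n=\sqrt{n}(\xi_n-\mathbb{E}\xi_n)$, where $\xi_n$ is Chatterjee's rank correlation of $(X_1,Y_1),\ldots,(X_n,Y_n)$, and suppose that $T_n$ converges in distribution to $\mathcal{N}(0,\sigma^2)$ as $n\to\infty$ for some $\sigma^2>0$. Suppose further that one of the following two conditions is fulfilled: (i) $m=o(\sqrt{n})$; (ii) $(X,Y)$ has a continuous distribution function, $Y$ cannot be expressed as a measurable function of $X$ almost surely, and $m=o(n)$. Suppose in addition that the sequence $(T_n)_{n\in\mathbb{N}}$ is uniformly square-integrable. Let $$T_{m,n}^*=\sqrt{m}\left(\xi_m^*-\mathbb{E}\left[\xi_m^*\mid (X_1,Y_1),\ldots,(X_n,Y_n)\right]\right)$$ be the bootstrap statistic. Let $f:\mathbb{R}\to\mathbb{R}$ be a continuous function such that, for some fixed $C>0$, $|f(x)|\le C(1+x^2)$ for all $x\in\mathbb{R}$. Then $$\mathbb{E}\left[f(T_{m,n}^* )\right]\longrightarrow\mathbb{E}\left[f(\sigma Z)\right]\quad\text{as } n\to\infty,$$ where $Z\sim\mathcal{N}(0,1)$.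
   Context: Chatterjee's rank correlation. For data $(x_1,y_1),\ldots,(x_n,y_n)\in\mathbb{R}^2$ ($n\ge 2$), rearrange the pairs as $(x_{(1)},y_{(1)}),\ldots,(x_{(n)},y_{(n)})$ so that $x_{(1)}\le\cdots\le x_{(n)}$, with ties among the $x$-values broken uniformly at random (by auxiliary randomness independent of everything else). Let $r_i=\#\{j: y_{(j)}\le y_{(i)}\}$ be the rank of $y_{(i)}$ and $l_i=\#\{j: y_{(j)}\ge y_{(i)}\}$. If there are no ties among $y_1,\ldots,y_n$, $$\xi_n=1-\frac{3\sum_{i=1}^{n-1}|r_{i+1}-r_i|}{n^2-1},$$ and if there are ties, $$\xi_n=1-\frac{n\sum_{i=1}^{n-1}|r_{i+1}-r_i|}{2\sum_{i=1}^n l_i(n-l_i)}.$$ If $y_1=\cdots=y_n$ (where the formula is $0/0$), $\xi_n$ is assigned an arbitrary fixed value in $[-1,1]$. Bootstrap. Given $(X_1,Y_1),\ldots,(X_n,Y_n)$, draw $m<n$ of these observations uniformly at random without replacement, independently of the sample, giving $(X_1^*,Y_1^* ),\ldots,(X_m^*,Y_m^* )$. Then $\xi_m^*$ is Chatterjee's rank correlation of $(X_1^*,Y_1^* ),\ldots,(X_m^*,Y_m^* )$ (with fresh independent tie-breaking if needed). Conditional quantities given $(X_1,Y_1),\ldots,(X_n,Y_n)$ average over the random resampling and the tie-breaking. A sequence $(T_n)$ is uniformly square-integrable if $(T_n^2)$ is uniformly integrable. *)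

theory Defs
  imports "HOL-Probability.Probability" "HOL-Library.Landau_Symbols"
begin

text \<open>
  Data are lists of pairs. The tie-breaker \<open>\<tau>\<close> is a list that enumerates the index set
  \<open>{..<length zs}\<close>. The data are first rearranged in the order given by \<open>\<tau>\<close> and then sorted
  stably by the first component, so observations with equal first component appear in the order
  in which \<open>\<tau>\<close> lists them. Hence a uniformly random \<open>\<tau>\<close> that is independent of the data breaks
  the ties uniformly at random.
\<close>

definition arrange :: "nat list \<Rightarrow> (real \<times> real) list \<Rightarrow> (real \<times> real) list" where
  "arrange \<tau> zs = sort_key fst (map (\<lambda>i. zs ! i) \<tau>)"

definition rank_le :: "real list \<Rightarrow> nat \<Rightarrow> nat" where
  "rank_le ys i = card {j. j < length ys \<and> ys ! j \<le> ys ! i}"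

definition rank_ge :: "real list \<Rightarrow> nat \<Rightarrow> nat" where
  "rank_ge ys i = card {j. j < length ys \<and> ys ! j \<ge> ys ! i}"

text \<open>
  The number \<open>c\<close> is the value assigned when all second components coincide. Since this case is
  tested first, \<open>c\<close> is also the value for data of length at most 1. Positions are counted from 0.
\<close>

definition chatterjee_xi :: "real \<Rightarrow> nat list \<Rightarrow> (real \<times> real) list \<Rightarrow> real" where
  "chatterjee_xi c \<tau> zs =
    (let n = length zs;
         ys = map snd (arrange \<tau> zs);
         r = (\<lambda>i. real (rank_le ys i));
         l = (\<lambda>i. real (rank_ge ys i));
         S = (\<Sum>i<n-1. \<bar>r (i+1) - r i\<bar>)
     in if \<forall>y\<in>set ys. \<forall>y'\<in>set ys. y = y' then c
        else if distinct ys then 1 - 3 * S / ((real n)\<^sup>2 - 1)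
        else 1 - real n * S / (2 * (\<Sum>i<n. l i * (real n - l i))))"

definition sample :: "(nat \<Rightarrow> 'a \<Rightarrow> real \<times> real) \<Rightarrow> nat \<Rightarrow> 'a \<Rightarrow> (real \<times> real) list" where
  "sample D n \<omega> = map (\<lambda>i. D i \<omega>) [0..<n]"

text \<open>The resample that consists of the observations with the indices listed in \<open>js\<close>.\<close>

definition resample ::
  "(nat \<Rightarrow> 'a \<Rightarrow> real \<times> real) \<Rightarrow> nat list \<Rightarrow> 'a \<Rightarrow> (real \<times> real) list" where
  "resample D js \<omega> = map (\<lambda>j. D j \<omega>) js"

definition draws :: "nat \<Rightarrow> nat \<Rightarrow> nat list set" where
  "draws m n = {js. length js = m \<and> distinct js \<and> set js \<subseteq> {..<n}}"

text \<open>
  The joint law of the auxiliary randomness for sample size \<open>n\<close> and resample size \<open>m\<close>: the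
  tie-breaker of the sample, the indices drawn without replacement, and the tie-breaker of the
  resample, which are mutually independent and each uniformly distributed.
\<close>

definition aux_law :: "nat \<Rightarrow> nat \<Rightarrow> (nat list \<times> nat list \<times> nat list) pmf" where
  "aux_law m n =
    pair_pmf (pmf_of_set (permutations_of_set {..<n}))
      (pair_pmf (pmf_of_set (draws m n)) (pmf_of_set (permutations_of_set {..<m})))"

text \<open>The \<open>\<sigma>\<close>-algebras generated by the whole sequence and by its first \<open>n\<close> members.\<close>

definition seq_algebra :: "'a measure \<Rightarrow> (nat \<Rightarrow> 'a \<Rightarrow> real \<times> real) \<Rightarrow> 'a measure" where
  "seq_algebra M D = vimage_algebra (space M) (\<lambda>\<omega> i. D i \<omega>) (\<Pi>\<^sub>M i\<in>UNIV. borel)"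

definition sample_algebra ::
  "'a measure \<Rightarrow> (nat \<Rightarrow> 'a \<Rightarrow> real \<times> real) \<Rightarrow> nat \<Rightarrow> 'a measure" where
  "sample_algebra M D n =
    vimage_algebra (space M) (\<lambda>\<omega>. \<lambda>i\<in>{..<n}. D i \<omega>) (\<Pi>\<^sub>M i\<in>{..<n}. borel)"

definition xi_stat ::
  "'a measure \<Rightarrow> real \<Rightarrow> (nat \<Rightarrow> 'a \<Rightarrow> real \<times> real) \<Rightarrow> (nat \<Rightarrow> 'a \<Rightarrow> nat list) \<Rightarrow>
   nat \<Rightarrow> 'a \<Rightarrow> real" where
  "xi_stat M c D \<tau> n \<omega> =
    sqrt (real n) *
      (chatterjee_xi c (\<tau> n \<omega>) (sample D n \<omega>)
        - (\<integral>\<omega>'. chatterjee_xi c (\<tau> n \<omega>') (sample D n \<omega>') \<partial>M))"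

definition xi_boot_stat ::
  "'a measure \<Rightarrow> real \<Rightarrow> (nat \<Rightarrow> 'a \<Rightarrow> real \<times> real) \<Rightarrow> (nat \<Rightarrow> nat) \<Rightarrow>
   (nat \<Rightarrow> 'a \<Rightarrow> nat list) \<Rightarrow> (nat \<Rightarrow> 'a \<Rightarrow> nat list) \<Rightarrow> nat \<Rightarrow> 'a \<Rightarrow> real" where
  "xi_boot_stat M c D m J \<tau>' n \<omega> =
    sqrt (real (m n)) *
      (chatterjee_xi c (\<tau>' n \<omega>) (resample D (J n \<omega>) \<omega>)
        - real_cond_exp M (sample_algebra M D n)
            (\<lambda>\<omega>'. chatterjee_xi c (\<tau>' n \<omega>') (resample D (J n \<omega>') \<omega>')) \<omega>)"

definition uniformly_integrable :: "'a measure \<Rightarrow> (nat \<Rightarrow> 'a \<Rightarrow> real) \<Rightarrow> bool" where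
  "uniformly_integrable M Z \<longleftrightarrow>
    (\<forall>n. Z n \<in> borel_measurable M) \<and>
    ((\<lambda>K::real. SUP n. \<integral>\<^sup>+\<omega>. ennreal \<bar>Z n \<omega>\<bar> * indicator {\<omega>. \<bar>Z n \<omega>\<bar> > K} \<omega> \<partial>M)
      \<longlongrightarrow> 0) at_top"

definition uniformly_square_integrable :: "'a measure \<Rightarrow> (nat \<Rightarrow> 'a \<Rightarrow> real) \<Rightarrow> bool" where
  "uniformly_square_integrable M Z \<longleftrightarrow> uniformly_integrable M (\<lambda>n \<omega>. (Z n \<omega>)\<^sup>2)"

end

theory Submission
  imports Defs
begin

text \<open>
  A resample drawn without replacement is itself an iid sample of size \<open>m\<close>, so
  \<open>V\<^sub>n = sqrt m * (\<xi>\<^sub>m\<^sup>* - E \<xi>\<^sub>m)\<close> has the law of \<open>T\<^sub>m\<close>. The bootstrap statistic is \<open>V\<^sub>n - R\<^sub>n\<close>, where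
  \<open>R\<^sub>n\<close> is \<open>sqrt m\<close> times the centred conditional expectation of \<open>\<xi>\<^sub>m\<^sup>*\<close> given the sample. This
  conditional expectation is a U-statistic of order \<open>m\<close>, whence (Hoeffding)
  \<open>E R\<^sub>n\<^sup>2 \<le> E T\<^sub>m\<^sup>2 / (n div m)\<close>. Uniform square-integrability bounds \<open>E T\<^sub>m\<^sup>2\<close>, and \<open>m / n \<longlonglongrightarrow> 0\<close> under
  either condition, so \<open>R\<^sub>n\<close> vanishes in \<open>L\<^sup>2\<close>. Truncating \<open>f\<close> then reduces the claim to weak
  convergence of \<open>T\<^sub>m\<close>, with the tails controlled by uniform square-integrability.
\<close>

subsection \<open>Measurability of the rank correlation\<close>

text \<open>The resample statistic is not a function of the data alone: it also depends on the drawn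
  indices and on a tie-breaker. Both take finitely many values almost surely and are independent of
  the whole sequence, so every expectation, conditional or not, reduces to a finite weighted sum
  over these values with the data kept fixed. Averaging over the tie-breaker alone produces
  \<open>mean_xi\<close>, the kernel of the U-statistic; Jensen's inequality then brings its
  variance back to that of the randomised correlation, which is what \<open>T\<close> measures. The
  comparison of \<open>V\<close> at \<open>n\<close> with \<open>T\<close> at \<open>m n\<close> is
  one of laws only: in general they use different observations and different tie-breakers. It is
  carried out through expectations of test functions of at most quadratic growth. The gain in the
  bound on \<open>R\<close> comes from disjointness: draws on disjoint index sets are independent,
  and a sample of size \<open>n\<close> holds \<open>n div m\<close> disjoint blocks of length
  \<open>m\<close>. The factor \<open>m\<close> from the scaling is absorbed by
  \<open>E T_m^2 = m Var xi_m\<close>, so only \<open>1 / (n div m)\<close> is left, which is at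
  most \<open>2 m / n\<close>.\<close>

lemma insort_key_map: "insort_key f (g x) (map g xs) = map g (insort_key (\<lambda>a. f (g a)) x xs)"
  by (induction xs) auto

text \<open>Sorting the data becomes sorting a list of indices by random keys. The result then
  ranges over index lists, a countable type, which makes its measurability accessible.\<close>

lemma sort_key_map: "sort_key f (map g xs) = map g (sort_key (\<lambda>a. f (g a)) xs)"
  by (induction xs) (simp_all add: insort_key_map)

lemma measurable_insort_key:
  fixes k :: "'b::countable \<Rightarrow> 'a \<Rightarrow> real"
  assumes k [measurable]: "\<And>i. k i \<in> borel_measurable N"
  shows "(\<lambda>\<omega>. insort_key (\<lambda>i. k i \<omega>) a xs) \<in> measurable N (count_space UNIV)"
proof (induction xs)
  case (Cons b xs)
  note Cons [measurable]
  show ?case by (simp, measurable)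
qed simp

text \<open>Each insertion is a cascade of comparisons of real keys; the induction passes through
  the partially sorted list, which has countably many possible values.\<close>

lemma measurable_sort_key:
  fixes k :: "'b::countable \<Rightarrow> 'a \<Rightarrow> real"
  assumes k [measurable]: "\<And>i. k i \<in> borel_measurable N"
  shows "(\<lambda>\<omega>. sort_key (\<lambda>i. k i \<omega>) xs) \<in> measurable N (count_space UNIV)"
proof (induction xs)
  case (Cons a xs)
  note Cons [measurable]
  have "(\<lambda>\<omega>. insort_key (\<lambda>i. k i \<omega>) a (sort_key (\<lambda>i. k i \<omega>) xs)) \<in> measurable N (count_space UNIV)"
    by (rule measurable_compose_countable[OF measurable_insort_key Cons]) (rule k)
  then show ?case by simp
qed simp

text \<open>A nonzero integer has modulus at least 1, and division by 0 yields 0. So both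
  denominators in the correlation, being integers, can be discarded whatever their size.\<close>

lemma abs_divide_int_le:
  fixes a :: real
  assumes "d = of_int k"
  shows "\<bar>a / d\<bar> \<le> \<bar>a\<bar>"
proof (cases "k = 0")
  case False
  then have "\<bar>real_of_int k\<bar> \<ge> 1" by linarith
  then have "\<bar>a\<bar> / \<bar>d\<bar> \<le> \<bar>a\<bar> / 1"
    unfolding assms by (intro divide_left_mono) auto
  then show ?thesis by simp
qed (simp add: assms)

text \<open>The part of the correlation after the sorting. The length \<open>n\<close> is a separate
  argument because a malformed tie-breaker may yield a list \<open>ys\<close> of another length, and
  the estimates below are wanted for every tie-breaker.\<close>

definition xi_of_list :: "real \<Rightarrow> nat \<Rightarrow> real list \<Rightarrow> real" where
  "xi_of_list c n ys =
    (let S = (\<Sum>i<n-1. \<bar>real (rank_le ys (i+1)) - real (rank_le ys i)\<bar>)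
     in if \<forall>y\<in>set ys. \<forall>y'\<in>set ys. y = y' then c
        else if distinct ys then 1 - 3 * S / ((real n)\<^sup>2 - 1)
        else 1 - real n * S / (2 * (\<Sum>i<n. real (rank_ge ys i) * (real n - real (rank_ge ys i)))))"

lemma chatterjee_xi_conv_xi_of_list:
  "chatterjee_xi c t zs = xi_of_list c (length zs) (map snd (arrange t zs))"
  by (simp add: chatterjee_xi_def xi_of_list_def Let_def)

lemma rank_le_le: "rank_le ys i \<le> length ys"
  unfolding rank_le_def by (rule order_trans[OF card_mono[of "{..<length ys}"]]) auto

text \<open>Deliberately crude: it depends on \<open>c\<close> and the lengths alone, holds for
  arbitrary lists, and serves integrability only. Moment bounds uniform in \<open>n\<close> come
  from uniform square-integrability.\<close>

lemma xi_of_list_bound: "\<bar>xi_of_list c n ys\<bar> \<le> \<bar>c\<bar> + 1 + (3 + real n) * (real n * real (length ys))"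
proof -
  define S where "S = (\<Sum>i<n-1. \<bar>real (rank_le ys (i+1)) - real (rank_le ys i)\<bar>)"
  let ?L = "\<Sum>i<n. real (rank_ge ys i) * (real n - real (rank_ge ys i))"
  have 0: "S \<ge> 0" unfolding S_def by (rule sum_nonneg) simp
  have "S \<le> (\<Sum>i<n-1. real (length ys))"
    unfolding S_def
  proof (rule sum_mono)
    fix i show "\<bar>real (rank_le ys (i+1)) - real (rank_le ys i)\<bar> \<le> real (length ys)"
      using rank_le_le[of ys i] rank_le_le[of ys "i+1"] by linarith
  qed
  also have "\<dots> \<le> real n * real (length ys)" by (simp add: mult_right_mono)
  finally have 1: "S \<le> real n * real (length ys)" .
  have "\<bar>3 * S / ((real n)\<^sup>2 - 1)\<bar> \<le> \<bar>3 * S\<bar>"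
    by (rule abs_divide_int_le[where k = "(int n)\<^sup>2 - 1"]) simp
  moreover have "\<bar>real n * S / (2 * ?L)\<bar> \<le> \<bar>real n * S\<bar>"
    by (rule abs_divide_int_le[where k = "2 * (\<Sum>i<n. int (rank_ge ys i) * (int n - int (rank_ge ys i)))"]) simp
  moreover have "\<bar>3 * S\<bar> \<le> 3 * (real n * real (length ys))" using 0 1 by simp
  moreover have "\<bar>real n * S\<bar> \<le> real n * (real n * real (length ys))"
    using 0 1 by (simp add: abs_mult mult_left_mono)
  ultimately show ?thesis
    unfolding xi_of_list_def Let_def S_def[symmetric]
    by (simp only: distrib_right split: if_split) (intro conjI impI; linarith)
qed

lemma chatterjee_xi_bound:
  "\<bar>chatterjee_xi c t zs\<bar>
    \<le> \<bar>c\<bar> + 1 + (3 + real (length zs)) * (real (length zs) * real (length t))"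
  unfolding chatterjee_xi_conv_xi_of_list
  by (rule order_trans[OF xi_of_list_bound]) (simp add: arrange_def)

text \<open>A position past the end is eventually read from the empty list, where the value is
  unspecified but constant in \<omega>; so the claim holds for every \<open>j\<close>.\<close>

lemma measurable_nth_list:
  fixes F :: "nat \<Rightarrow> 'a \<Rightarrow> real"
  assumes "\<And>i. i \<in> set s \<Longrightarrow> F i \<in> borel_measurable N"
  shows "(\<lambda>\<omega>. map (\<lambda>i. F i \<omega>) s ! j) \<in> borel_measurable N"
  using assms
proof (induction s arbitrary: j)
  case (Cons a s)
  then show ?case by (cases j) auto
qed simp

text \<open>Writes a rank as a finite sum of indicators of comparisons, a form in which
  measurability is immediate.\<close>

lemma card_eq_sum_less: "card {j. j < n \<and> P j} = (\<Sum>j<(n::nat). if P j then 1 else 0)"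
  by (subst sum.If_cases) (auto intro!: arg_cong[where f = card])

lemma measurable_xi_of_list:
  assumes [measurable]: "\<And>i. (\<lambda>\<omega>. ys \<omega> ! i) \<in> borel_measurable N"
    and len: "\<And>\<omega>. length (ys \<omega>) = l"
  shows "(\<lambda>\<omega>. xi_of_list c n (ys \<omega>)) \<in> borel_measurable N"
proof -
  have [measurable]: "(\<lambda>\<omega>. real (rank_le (ys \<omega>) i)) \<in> borel_measurable N"
    "(\<lambda>\<omega>. real (rank_ge (ys \<omega>) i)) \<in> borel_measurable N" for i
    unfolding rank_le_def rank_ge_def len card_eq_sum_less of_nat_sum by measurable
  have 1: "(\<forall>y\<in>set (ys \<omega>). \<forall>y'\<in>set (ys \<omega>). y = y') \<longleftrightarrow> (\<forall>i<l. \<forall>j<l. ys \<omega> ! i = ys \<omega> ! j)" for \<omega>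
    using len[of \<omega>] by (metis in_set_conv_nth)
  have 2: "distinct (ys \<omega>) \<longleftrightarrow> (\<forall>i<l. \<forall>j<l. i \<noteq> j \<longrightarrow> ys \<omega> ! i \<noteq> ys \<omega> ! j)" for \<omega>
    using len[of \<omega>] by (simp add: distinct_conv_nth)
  show ?thesis
    unfolding xi_of_list_def Let_def 1 2 by measurable
qed

text \<open>The random sorted index list \<open>s\<close> takes countably many values; on each of
  them the correlation is a fixed function of coordinates. Measurability is asked only of the listed
  observations, so that the lemma also applies to the sub-algebra of a finite sample.\<close>

lemma measurable_chatterjee_xi:
  fixes D :: "'i \<Rightarrow> 'a \<Rightarrow> real \<times> real"
  assumes D: "\<And>j. j \<in> set js \<Longrightarrow> D j \<in> measurable N borel"
  shows "(\<lambda>\<omega>. chatterjee_xi c t (map (\<lambda>j. D j \<omega>) js)) \<in> borel_measurable N"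
proof -
  define Z where "Z \<omega> = map (\<lambda>j. D j \<omega>) js" for \<omega>
  have Z [measurable]: "(\<lambda>\<omega>. Z \<omega> ! i) \<in> measurable N borel" for i
    unfolding Z_def using D
  proof (induction js arbitrary: i)
    case (Cons a js)
    then show ?case by (cases i) auto
  qed simp
  have [measurable]: "(\<lambda>\<omega>. fst (Z \<omega> ! i)) \<in> borel_measurable N" "(\<lambda>\<omega>. snd (Z \<omega> ! i)) \<in> borel_measurable N" for i
    by (auto intro!: measurable_compose[OF Z] simp: borel_prod[symmetric])
  define s where "s \<omega> = sort_key (\<lambda>i. fst (Z \<omega> ! i)) t" for \<omega>
  have s: "s \<in> measurable N (count_space UNIV)"
    unfolding s_def by (rule measurable_sort_key) simp
  have eq: "map snd (arrange t (Z \<omega>)) = map (\<lambda>i. snd (Z \<omega> ! i)) (s \<omega>)" for \<omega>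
    by (simp add: arrange_def sort_key_map s_def comp_def)
  have "(\<lambda>\<omega>. xi_of_list c (length js) (map (\<lambda>i. snd (Z \<omega> ! i)) (s \<omega>))) \<in> borel_measurable N"
    by (rule measurable_compose_countable[OF _ s])
       (auto intro!: measurable_xi_of_list measurable_nth_list)
  then show ?thesis
    unfolding chatterjee_xi_conv_xi_of_list Z_def[symmetric] eq by (simp add: Z_def)
qed

subsection \<open>Averages over draws without replacement\<close>

lemma finite_draws [simp]: "finite (draws m n)"
  by (rule finite_subset[OF _ finite_lists_length_eq[of "{..<n}" m]]) (auto simp: draws_def)

lemma draws_nonempty: "m \<le> n \<Longrightarrow> draws m n \<noteq> {}"
proof -
  assume "m \<le> n"
  then have "[0..<m] \<in> draws m n" by (auto simp: draws_def)
  then show ?thesis by auto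
qed

lemma block_in_draws:
  assumes "ls \<in> draws N n" "a + m \<le> N"
  shows "take m (drop a ls) \<in> draws m n"
proof -
  have "set (take m (drop a ls)) \<subseteq> set ls"
    by (meson order_trans set_drop_subset set_take_subset)
  with assms show ?thesis by (auto simp: draws_def)
qed

text \<open>Deleting the block leaves an ordered selection of \<open>N - m\<close> distinct indices
  from the \<open>n - m\<close> indices outside \<open>js\<close>, and the block can be reinserted.
  The count is thus a falling factorial, the same for every \<open>js\<close> and every position
  \<open>a\<close>.\<close>

lemma card_draws_fibre:
  assumes "a + m \<le> N" "N \<le> n" and js: "js \<in> draws m n"
  shows "card {ls \<in> draws N n. take m (drop a ls) = js} = \<Prod>{n - N + 1..n - m}"
proof -
  let ?A = "{ls \<in> draws N n. take m (drop a ls) = js}"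
  let ?B = "{xs. length xs = N - m \<and> distinct xs \<and> set xs \<subseteq> {..<n} - set js}"
  have js': "length js = m" "distinct js" "set js \<subseteq> {..<n}" using js by (auto simp: draws_def)
  have "bij_betw (\<lambda>ls. take a ls @ drop (a + m) ls) ?A ?B"
  proof (rule bij_betw_byWitness[where f' = "\<lambda>xs. take a xs @ js @ drop a xs"])
    have split: "ls = take a ls @ js @ drop (a + m) ls" if "ls \<in> ?A" for ls
    proof -
      have "drop a ls = js @ drop m (drop a ls)"
        using append_take_drop_id[of m "drop a ls"] that by simp
      then show ?thesis using append_take_drop_id[of a ls] by (simp add: add.commute)
    qed
    show "\<forall>ls\<in>?A. take a (take a ls @ drop (a + m) ls) @ js @ drop a (take a ls @ drop (a + m) ls) = ls"
    proof
      fix ls assume ls: "ls \<in> ?A"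
      then have "length (take a ls) = a" using assms by (auto simp: draws_def)
      then show "take a (take a ls @ drop (a + m) ls) @ js @ drop a (take a ls @ drop (a + m) ls) = ls"
        using split[OF ls] by simp
    qed
    show "\<forall>xs\<in>?B. take a (take a xs @ js @ drop a xs) @ drop (a + m) (take a xs @ js @ drop a xs) = xs"
      using assms js' by auto
    show "(\<lambda>ls. take a ls @ drop (a + m) ls) ` ?A \<subseteq> ?B"
    proof (rule image_subsetI)
      fix ls assume ls: "ls \<in> ?A"
      have "distinct (take a ls @ js @ drop (a + m) ls)" "set (take a ls @ js @ drop (a + m) ls) \<subseteq> {..<n}"
        using ls split[OF ls] by (auto simp: draws_def)
      moreover have "length (take a ls @ drop (a + m) ls) = N - m"
        using ls assms by (auto simp: draws_def)
      ultimately show "take a ls @ drop (a + m) ls \<in> ?B" by auto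
    qed
    show "(\<lambda>xs. take a xs @ js @ drop a xs) ` ?B \<subseteq> ?A"
    proof (rule image_subsetI)
      fix xs assume xs: "xs \<in> ?B"
      then have l: "length (take a xs) = a" using assms by auto
      have "set (take a xs) \<inter> set (drop a xs) = {}"
        using xs by (simp add: set_take_disj_set_drop_if_distinct)
      moreover have "set (take a xs) \<subseteq> set xs" "set (drop a xs) \<subseteq> set xs"
        by (simp_all add: set_take_subset set_drop_subset)
      ultimately have "distinct (take a xs @ js @ drop a xs)" "set (take a xs @ js @ drop a xs) \<subseteq> {..<n}"
        using xs js' by auto
      moreover have "length (take a xs @ js @ drop a xs) = N" using xs js' assms by auto
      moreover have "take m (drop a (take a xs @ js @ drop a xs)) = js" using l js' by simp
      ultimately show "take a xs @ js @ drop a xs \<in> ?A" unfolding draws_def by blast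
    qed
  qed
  then have "card ?A = card ?B" by (rule bij_betw_same_card)
  also have "card ({..<n} - set js) = n - m" using js' by (simp add: card_Diff_subset distinct_card)
  then have "card ?B = \<Prod>{n - N + 1..n - m}"
    using assms by (subst card_lists_distinct_length_eq) auto
  finally show ?thesis .
qed

text \<open>Since all fibres have equal size, any window of length \<open>m\<close> of a uniform
  draw is itself a uniform draw.\<close>

lemma sum_draws_block:
  fixes \<phi> :: "nat list \<Rightarrow> real"
  assumes "a + m \<le> N" "N \<le> n"
  shows "(\<Sum>ls\<in>draws N n. \<phi> (take m (drop a ls))) = real (\<Prod>{n - N + 1..n - m}) * (\<Sum>js\<in>draws m n. \<phi> js)"
proof -
  have "(\<Sum>ls\<in>draws N n. \<phi> (take m (drop a ls)))
      = (\<Sum>js\<in>draws m n. \<Sum>ls\<in>{ls \<in> draws N n. take m (drop a ls) = js}. \<phi> (take m (drop a ls)))"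
    using assms by (intro sum.group[symmetric]) (auto intro: block_in_draws)
  also have "\<dots> = (\<Sum>js\<in>draws m n. real (\<Prod>{n - N + 1..n - m}) * \<phi> js)"
    using assms by (intro sum.cong refl) (simp add: card_draws_fibre del: of_nat_prod)
  finally show ?thesis by (simp add: sum_distrib_left)
qed

text \<open>
  The average over all draws equals an average of means over \<open>n div m\<close> disjoint blocks, so
  convexity of the square reduces the bound to the variance of a mean of uncorrelated terms.
\<close>

lemma (in prob_space) second_moment_average_draws:
  fixes g :: "nat list \<Rightarrow> 'a \<Rightarrow> real"
  assumes m: "0 < m" "m \<le> n"
    and int: "\<And>js ks. js \<in> draws m n \<Longrightarrow> ks \<in> draws m n \<Longrightarrow> integrable M (\<lambda>\<omega>. g js \<omega> * g ks \<omega>)"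
    and v: "\<And>js. js \<in> draws m n \<Longrightarrow> expectation (\<lambda>\<omega>. (g js \<omega>)\<^sup>2) \<le> v"
    and orth: "\<And>js ks. js \<in> draws m n \<Longrightarrow> ks \<in> draws m n \<Longrightarrow> set js \<inter> set ks = {}
      \<Longrightarrow> expectation (\<lambda>\<omega>. g js \<omega> * g ks \<omega>) = 0"
  shows "expectation (\<lambda>\<omega>. ((\<Sum>js\<in>draws m n. g js \<omega>) / card (draws m n))\<^sup>2) \<le> v / real (n div m)"
proof -
  define k where "k = n div m"
  \<comment> \<open>The total length of \<open>k\<close> consecutive blocks; draws of length
    \<open>N\<close> instead of \<open>n\<close> leave out the remainder
    \<open>n mod m\<close>.\<close>
  define N where "N = k * m"
  have k: "0 < k" using m unfolding k_def by (simp add: div_greater_zero_iff)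
  have N: "N \<le> n" unfolding N_def k_def by simp
  define b where "b i ls = take m (drop (i * m) ls)" for i and ls :: "nat list"
  define W where "W ls \<omega> = (\<Sum>i<k. g (b i ls) \<omega>) / real k" for ls \<omega>
  define c where "c = real (\<Prod>{n - N + 1..n - m})"
  have le: "i * m + m \<le> N" if "i < k" for i
    using mult_right_mono[of "Suc i" k m] that unfolding N_def by simp
  have sum_b: "(\<Sum>ls\<in>draws N n. \<phi> (b i ls)) = c * (\<Sum>js\<in>draws m n. \<phi> js)" if "i < k" for \<phi> i
    unfolding b_def c_def by (rule sum_draws_block[OF le[OF that] N])
  have bd: "b i ls \<in> draws m n" if "i < k" "ls \<in> draws N n" for i ls
    unfolding b_def by (rule block_in_draws[OF that(2) le[OF that(1)]])
  \<comment> \<open>Summing the constant 1 gives the normalisation, which also shows that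
    \<open>c\<close> is nonzero.\<close>
  have cardN: "real (card (draws N n)) = c * real (card (draws m n))"
    using sum_b[OF k, of "\<lambda>_. 1"] by simp
  have posN: "real (card (draws N n)) > 0" using draws_nonempty[OF N] by (simp add: card_gt_0_iff)
  then have c: "c \<noteq> 0" using cardN by auto
  have avg: "(\<Sum>js\<in>draws m n. g js \<omega>) / card (draws m n) = (\<Sum>ls\<in>draws N n. W ls \<omega>) / card (draws N n)" for \<omega>
  proof -
    have "(\<Sum>ls\<in>draws N n. W ls \<omega>) = (\<Sum>i<k. \<Sum>ls\<in>draws N n. g (b i ls) \<omega>) / real k"
      unfolding W_def by (subst sum.swap) (simp add: sum_divide_distrib)
    also have "\<dots> = c * (\<Sum>js\<in>draws m n. g js \<omega>)"
      using k by (simp add: sum_b[of _ "\<lambda>js. g js \<omega>"])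
    finally show ?thesis using c cardN by simp
  qed
  have intW: "integrable M (\<lambda>\<omega>. (W ls \<omega>)\<^sup>2)"
    and W: "expectation (\<lambda>\<omega>. (W ls \<omega>)\<^sup>2) \<le> v / real k" if ls: "ls \<in> draws N n" for ls
  proof -
    have eq: "(W ls \<omega>)\<^sup>2 = (\<Sum>i<k. \<Sum>j<k. g (b i ls) \<omega> * g (b j ls) \<omega>) / (real k)\<^sup>2" for \<omega>
      unfolding W_def by (simp add: power_divide power2_eq_square sum_product)
    show "integrable M (\<lambda>\<omega>. (W ls \<omega>)\<^sup>2)"
      unfolding eq using ls
      by (intro integrable_divide_zero Bochner_Integration.integrable_sum int bd impI) auto
    have disj: "set (b i ls) \<inter> set (b j ls) = {}" if ij: "i < k" "j < k" "i < j" for i j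
    proof -
      have "i * m + m \<le> j * m" using mult_right_mono[of "Suc i" j m] ij by simp
      then have "set (b j ls) \<subseteq> set (drop (i * m + m) ls)"
        unfolding b_def by (meson order_trans set_take_subset set_drop_subset_set_drop)
      moreover have "drop (i * m + m) ls = drop m (drop (i * m) ls)" by (simp add: add.commute)
      moreover have "set (take m (drop (i * m) ls)) \<inter> set (drop m (drop (i * m) ls)) = {}"
        using ls by (intro set_take_disj_set_drop_if_distinct) (auto simp: draws_def)
      ultimately show ?thesis unfolding b_def by auto
    qed
    have "expectation (\<lambda>\<omega>. (W ls \<omega>)\<^sup>2)
        = (\<Sum>i<k. \<Sum>j<k. expectation (\<lambda>\<omega>. g (b i ls) \<omega> * g (b j ls) \<omega>)) / (real k)\<^sup>2"
      unfolding eq integral_divide_zero using ls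
      by (intro arg_cong2[where f = "(/)"] refl)
        (subst Bochner_Integration.integral_sum; auto intro!: Bochner_Integration.integrable_sum int bd sum.cong Bochner_Integration.integral_sum)
    \<comment> \<open>Distinct blocks of one draw have disjoint index sets, so \<open>orth\<close>
      removes every off-diagonal term; the \<open>k\<close> diagonal terms over \<open>k^2\<close>
      leave \<open>1 / k\<close>.\<close>
    also have "\<dots> = (\<Sum>i<k. \<Sum>j<k. if i = j then expectation (\<lambda>\<omega>. (g (b i ls) \<omega>)\<^sup>2) else 0) / (real k)\<^sup>2"
    proof (intro arg_cong2[where f = "(/)"] sum.cong refl)
      fix i j assume ij: "i \<in> {..<k}" "j \<in> {..<k}"
      show "expectation (\<lambda>\<omega>. g (b i ls) \<omega> * g (b j ls) \<omega>)
          = (if i = j then expectation (\<lambda>\<omega>. (g (b i ls) \<omega>)\<^sup>2) else 0)"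
      proof (cases "i = j")
        case False
        then have "set (b i ls) \<inter> set (b j ls) = {}"
          using disj[of i j] disj[of j i] ij by (cases "i < j") auto
        then show ?thesis using False ij ls by (simp add: orth bd)
      qed (simp add: power2_eq_square)
    qed
    also have "\<dots> = (\<Sum>i<k. expectation (\<lambda>\<omega>. (g (b i ls) \<omega>)\<^sup>2)) / (real k)\<^sup>2" by simp
    also have "\<dots> \<le> (\<Sum>i<k. v) / (real k)\<^sup>2"
      using ls by (intro divide_right_mono sum_mono v bd) auto
    also have "\<dots> = v / real k" by (simp add: power2_eq_square)
    finally show "expectation (\<lambda>\<omega>. (W ls \<omega>)\<^sup>2) \<le> v / real k" .
  qed
  have "expectation (\<lambda>\<omega>. ((\<Sum>js\<in>draws m n. g js \<omega>) / card (draws m n))\<^sup>2)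
      \<le> expectation (\<lambda>\<omega>. (\<Sum>ls\<in>draws N n. (W ls \<omega>)\<^sup>2) / card (draws N n))"
  proof (rule integral_mono)
    have "integrable M (\<lambda>\<omega>. (\<Sum>js\<in>draws m n. \<Sum>ks\<in>draws m n. g js \<omega> * g ks \<omega>) / (real (card (draws m n)))\<^sup>2)"
      by (intro integrable_divide_zero Bochner_Integration.integrable_sum int impI) auto
    then show "integrable M (\<lambda>\<omega>. ((\<Sum>js\<in>draws m n. g js \<omega>) / card (draws m n))\<^sup>2)"
      by (simp add: power_divide power2_eq_square sum_product)
    show "integrable M (\<lambda>\<omega>. (\<Sum>ls\<in>draws N n. (W ls \<omega>)\<^sup>2) / card (draws N n))"
      by (intro integrable_divide_zero Bochner_Integration.integrable_sum intW impI) auto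
    fix \<omega>
    have "(\<Sum>ls\<in>draws N n. W ls \<omega>)\<^sup>2 \<le> (\<Sum>ls\<in>draws N n. (W ls \<omega>)\<^sup>2) * card (draws N n)"
      by (rule sum_squared_le_sum_of_squares)
    then show "((\<Sum>js\<in>draws m n. g js \<omega>) / card (draws m n))\<^sup>2 \<le> (\<Sum>ls\<in>draws N n. (W ls \<omega>)\<^sup>2) / card (draws N n)"
      unfolding avg using posN by (simp add: power_divide power2_eq_square field_simps)
  qed
  also have "\<dots> = (\<Sum>ls\<in>draws N n. expectation (\<lambda>\<omega>. (W ls \<omega>)\<^sup>2)) / card (draws N n)"
    by (simp add: intW Bochner_Integration.integral_sum)
  also have "\<dots> \<le> (\<Sum>ls\<in>draws N n. v / real k) / card (draws N n)"
    by (intro divide_right_mono sum_mono W) auto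
  also have "\<dots> = v / real k" using posN draws_nonempty[OF N] by simp
  finally show ?thesis by (simp add: k_def)
qed

subsection \<open>Discrete randomness independent of a sub-algebra\<close>

text \<open>The algebras generated by the indicator and by \<open>\<phi>\<close> lie inside
  \<open>H\<close> and \<open>F\<close>, so they inherit independence. This evaluates one term when
  an expectation is split by the value of a discrete variable.\<close>

lemma (in prob_space) expectation_indicator_mult_indep:
  fixes \<phi> :: "'a \<Rightarrow> real"
  assumes indep: "indep_set (sets F) (sets H)"
    and sp: "space F = space M" "space H = space M"
    and \<phi>: "\<phi> \<in> borel_measurable F" "integrable M \<phi>" and B: "B \<in> sets H"
  shows "expectation (\<lambda>\<omega>. indicator B \<omega> * \<phi> \<omega>) = prob B * expectation \<phi>"
proof -
  have sub: "sets F \<subseteq> events" "sets H \<subseteq> events"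
    using indep unfolding indep_set_def indep_sets_def by (auto split: bool.splits)
  have BM: "B \<in> events" using sub B by auto
  have \<phi>M: "\<phi> \<in> borel_measurable M"
    using \<phi>(2) by simp
  have Bm: "(indicator B :: 'a \<Rightarrow> real) \<in> borel_measurable H" using B by simp
  have "indep_var borel (indicator B :: 'a \<Rightarrow> real) borel \<phi>"
    unfolding indep_var_eq
  proof (intro conjI)
    show "random_variable borel (indicator B :: 'a \<Rightarrow> real)" "random_variable borel \<phi>"
      using BM \<phi>M by auto
    have 1: "sigma_sets (space M) {\<phi> -` A \<inter> space M |A. A \<in> sets borel} \<subseteq> sets F"
      unfolding sp(1)[symmetric] by (rule sets.sigma_sets_subset) (use \<phi>(1) in \<open>auto intro: measurable_sets\<close>)
    have 2: "sigma_sets (space M) {(indicator B :: 'a \<Rightarrow> real) -` A \<inter> space M |A. A \<in> sets borel} \<subseteq> sets H"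
      unfolding sp(2)[symmetric] by (rule sets.sigma_sets_subset) (use Bm in \<open>auto intro: measurable_sets\<close>)
    show "indep_set (sigma_sets (space M) {(indicator B :: 'a \<Rightarrow> real) -` A \<inter> space M |A. A \<in> sets borel})
        (sigma_sets (space M) {\<phi> -` A \<inter> space M |A. A \<in> sets borel})"
    proof (rule indep_setI)
      fix A E
      assume "A \<in> sigma_sets (space M) {(indicator B :: 'a \<Rightarrow> real) -` A \<inter> space M |A. A \<in> sets borel}"
        and "E \<in> sigma_sets (space M) {\<phi> -` A \<inter> space M |A. A \<in> sets borel}"
      then have "A \<in> sets H" "E \<in> sets F" using 1 2 by (meson subsetD)+
      then have "prob (E \<inter> A) = prob E * prob A" using indep unfolding indep_sets2_eq by meson
      then show "prob (A \<inter> E) = prob A * prob E" by (simp add: Int_commute mult.commute)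
    qed (use 1 2 sub in \<open>meson order_trans\<close>)+
  qed
  moreover have "integrable M (indicator B :: 'a \<Rightarrow> real)"
    using BM by (simp add: integrable_indicator_iff emeasure_eq_measure)
  ultimately show ?thesis
    using indep_var_lebesgue_integral[OF _ _ \<phi>(2)] BM by simp
qed

lemma integral_pmf_finite:
  fixes h :: "'s \<Rightarrow> real"
  assumes "finite (set_pmf p)"
  shows "(\<integral>s. h s \<partial>measure_pmf p) = (\<Sum>s\<in>set_pmf p. pmf p s * h s)"
  using assms by (subst integral_measure_pmf_real[of "set_pmf p"]) (auto simp: mult.commute)

text \<open>Fubini in discrete form: split according to the value of \<open>S\<close>, which lies in
  a finite set almost surely, and factor each term by independence. Finiteness is why the bound
  \<open>b\<close> may vary with \<open>s\<close>.\<close>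

lemma (in prob_space) expectation_indep_pmf:
  fixes G :: "'s::countable \<Rightarrow> 'a \<Rightarrow> real"
  assumes S [measurable]: "S \<in> measurable M (count_space UNIV)"
    and law: "distr M (count_space UNIV) S = measure_pmf p" and fin: "finite (set_pmf p)"
    and sp: "space F = space M"
    and indep: "indep_set (sets F) (sets (vimage_algebra (space M) S (count_space UNIV)))"
    and G: "\<And>s. G s \<in> borel_measurable F" and b: "\<And>s \<omega>. \<bar>G s \<omega>\<bar> \<le> b s"
  shows "expectation (\<lambda>\<omega>. G (S \<omega>) \<omega>) = (\<integral>s. expectation (G s) \<partial>measure_pmf p)"
    and "integrable M (\<lambda>\<omega>. G (S \<omega>) \<omega>)"
proof -
  let ?H = "vimage_algebra (space M) S (count_space UNIV)"
  have sub: "sets F \<subseteq> events"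
    using indep unfolding indep_set_def indep_sets_def by (auto split: bool.splits)
  then have GM [measurable]: "G s \<in> borel_measurable M" for s
    using G[of s] sp by (auto intro: measurable_from_subalg simp: subalgebra_def)
  have intG: "integrable M (G s)" for s
    by (rule integrable_const_bound[where B = "b s"]) (auto simp: b)
  have intB: "integrable M (\<lambda>\<omega>. indicator (S -` {s} \<inter> space M) \<omega> * G s \<omega>)" for s
    using integrable_mult_indicator[OF _ intG[of s], of "S -` {s} \<inter> space M"] by simp
  have "AE s in distr M (count_space UNIV) S. s \<in> set_pmf p"
    unfolding law by (rule AE_measure_pmf)
  then have supp: "AE \<omega> in M. S \<omega> \<in> set_pmf p" by (rule AE_distrD[OF S])
  have meas [measurable]: "(\<lambda>\<omega>. G (S \<omega>) \<omega>) \<in> borel_measurable M"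
    by (rule measurable_compose_countable[OF GM S])
  have ae: "AE \<omega> in M. G (S \<omega>) \<omega> = (\<Sum>s\<in>set_pmf p. indicator (S -` {s} \<inter> space M) \<omega> * G s \<omega>)"
    using supp AE_space
  proof eventually_elim
    case (elim \<omega>)
    have "(\<Sum>s\<in>set_pmf p. indicator (S -` {s} \<inter> space M) \<omega> * G s \<omega>)
        = (\<Sum>s\<in>set_pmf p. if s = S \<omega> then G s \<omega> else 0)"
      using elim by (intro sum.cong) (auto simp: indicator_def)
    then show ?case using elim fin by simp
  qed
  show "integrable M (\<lambda>\<omega>. G (S \<omega>) \<omega>)"
  proof (rule integrable_cong_AE_imp[OF _ meas])
    show "integrable M (\<lambda>\<omega>. \<Sum>s\<in>set_pmf p. indicator (S -` {s} \<inter> space M) \<omega> * G s \<omega>)"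
      by (rule Bochner_Integration.integrable_sum) (rule intB)
    show "AE \<omega> in M. (\<Sum>s\<in>set_pmf p. indicator (S -` {s} \<inter> space M) \<omega> * G s \<omega>) = G (S \<omega>) \<omega>"
      using ae by eventually_elim simp
  qed
  have "expectation (\<lambda>\<omega>. G (S \<omega>) \<omega>)
      = expectation (\<lambda>\<omega>. \<Sum>s\<in>set_pmf p. indicator (S -` {s} \<inter> space M) \<omega> * G s \<omega>)"
    by (rule integral_cong_AE[OF _ _ ae]) auto
  also have "\<dots> = (\<Sum>s\<in>set_pmf p. expectation (\<lambda>\<omega>. indicator (S -` {s} \<inter> space M) \<omega> * G s \<omega>))"
    by (rule Bochner_Integration.integral_sum) (rule intB)
  also have "\<dots> = (\<Sum>s\<in>set_pmf p. pmf p s * expectation (G s))"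
  proof (rule sum.cong[OF refl])
    fix s
    have "expectation (\<lambda>\<omega>. indicator (S -` {s} \<inter> space M) \<omega> * G s \<omega>) = prob (S -` {s} \<inter> space M) * expectation (G s)"
      by (rule expectation_indicator_mult_indep[OF indep sp _ G intG]) (auto intro: in_vimage_algebra)
    also have "prob (S -` {s} \<inter> space M) = measure (distr M (count_space UNIV) S) {s}"
      by (simp add: measure_distr)
    finally show "expectation (\<lambda>\<omega>. indicator (S -` {s} \<inter> space M) \<omega> * G s \<omega>) = pmf p s * expectation (G s)"
      unfolding law by (simp add: measure_pmf_single)
  qed
  finally show "expectation (\<lambda>\<omega>. G (S \<omega>) \<omega>) = (\<integral>s. expectation (G s) \<partial>measure_pmf p)"
    by (simp add: integral_pmf_finite[OF fin])
qed

text \<open>The freezing lemma: conditioning averages over \<open>S\<close> and keeps the data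
  fixed. For \<open>A\<close> in \<open>F'\<close> the preceding lemma applies to the indicator of
  \<open>A\<close> times \<open>G\<close>. Independence is stated for the larger algebra
  \<open>F\<close>, measurability of \<open>G\<close> for the smaller \<open>F'\<close>.\<close>

lemma (in prob_space) real_cond_exp_indep_pmf:
  fixes G :: "'s::countable \<Rightarrow> 'a \<Rightarrow> real"
  assumes S: "S \<in> measurable M (count_space UNIV)"
    and law: "distr M (count_space UNIV) S = measure_pmf p" and fin: "finite (set_pmf p)"
    and sp: "space F = space M"
    and indep: "indep_set (sets F) (sets (vimage_algebra (space M) S (count_space UNIV)))"
    and sub: "subalgebra F F'"
    and G: "\<And>s. G s \<in> borel_measurable F'" and b: "\<And>s \<omega>. \<bar>G s \<omega>\<bar> \<le> b s"
  shows "AE \<omega> in M. real_cond_exp M F' (\<lambda>\<omega>. G (S \<omega>) \<omega>) \<omega> = (\<integral>s. G s \<omega> \<partial>measure_pmf p)"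
proof -
  have F: "sets F \<subseteq> events"
    using indep unfolding indep_set_def indep_sets_def by (auto split: bool.splits)
  have subM: "subalgebra M F'" using F sub sp by (auto simp: subalgebra_def)
  interpret finite_measure_subalgebra M F' using subM by unfold_locales
  have GF: "G s \<in> borel_measurable F" for s by (rule measurable_from_subalg[OF sub G])
  have GM: "G s \<in> borel_measurable M" for s by (rule measurable_from_subalg[OF subM G])
  have intG: "integrable M (G s)" for s
    by (rule integrable_const_bound[where B = "b s"]) (auto simp: b GM)
  note eq = integral_pmf_finite[OF fin]
  show ?thesis
  proof (rule real_cond_exp_charact)
    show "integrable M (\<lambda>\<omega>. G (S \<omega>) \<omega>)"
      by (rule expectation_indep_pmf(2)[OF S law fin sp indep GF b])
    show "integrable M (\<lambda>\<omega>. \<integral>s. G s \<omega> \<partial>measure_pmf p)"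
      unfolding eq using intG by auto
    show "(\<lambda>\<omega>. \<integral>s. G s \<omega> \<partial>measure_pmf p) \<in> borel_measurable F'"
      unfolding eq using G by auto
    fix A assume A: "A \<in> sets F'"
    have AF: "A \<in> sets F" using A sub by (auto simp: subalgebra_def)
    have AM: "A \<in> events" using AF F by auto
    have int: "integrable M (\<lambda>\<omega>. indicator A \<omega> * G s \<omega>)" for s
      using integrable_mult_indicator[OF AM intG[of s]] by simp
    have "(LINT \<omega>:A|M. G (S \<omega>) \<omega>) = expectation (\<lambda>\<omega>. indicator A \<omega> * G (S \<omega>) \<omega>)"
      by (simp add: set_lebesgue_integral_def)
    also have "\<dots> = (\<integral>s. expectation (\<lambda>\<omega>. indicator A \<omega> * G s \<omega>) \<partial>measure_pmf p)"
      by (rule expectation_indep_pmf(1)[OF S law fin sp indep, where G = "\<lambda>s \<omega>. indicator A \<omega> * G s \<omega>" and b = "\<lambda>s. \<bar>b s\<bar>"])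
        (use AF GF b in \<open>auto simp: indicator_def intro: order_trans[OF b abs_ge_self]\<close>)
    also have "\<dots> = expectation (\<lambda>\<omega>. \<Sum>s\<in>set_pmf p. pmf p s * (indicator A \<omega> * G s \<omega>))"
      unfolding eq using int by (subst Bochner_Integration.integral_sum) auto
    also have "\<dots> = (LINT \<omega>:A|M. \<integral>s. G s \<omega> \<partial>measure_pmf p)"
      unfolding eq set_lebesgue_integral_def
      by (intro Bochner_Integration.integral_cong) (auto simp: sum_distrib_left mult.left_commute)
    finally show "(LINT \<omega>:A|M. G (S \<omega>) \<omega>) = (LINT \<omega>:A|M. \<integral>s. G s \<omega> \<partial>measure_pmf p)" .
  qed
qed

subsection \<open>Convergence of integrals under quadratic growth\<close>

text \<open>A trapezoid, continuous and not an indicator, so that truncation turns a continuous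
  function into a bounded uniformly continuous one.\<close>

definition cutoff :: "real \<Rightarrow> real \<Rightarrow> real" where
  "cutoff K x = max 0 (min 1 (K + 1 - \<bar>x\<bar>))"

lemma cutoff_bounds: "0 \<le> cutoff K x" "cutoff K x \<le> 1"
  by (auto simp: cutoff_def)

lemma cutoff_eq_1: "\<bar>x\<bar> \<le> K \<Longrightarrow> cutoff K x = 1"
  by (simp add: cutoff_def)

lemma cutoff_eq_0: "\<bar>x\<bar> \<ge> K + 1 \<Longrightarrow> cutoff K x = 0"
  by (simp add: cutoff_def)

lemma continuous_on_cutoff [continuous_intros]: "continuous_on A (cutoff K)"
  unfolding cutoff_def by (intro continuous_intros)

lemma uniformly_continuous_mult_cutoff:
  fixes f :: "real \<Rightarrow> real"
  assumes f: "continuous_on UNIV f"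
  shows "uniformly_continuous_on UNIV (\<lambda>x. f x * cutoff K x)"
  unfolding uniformly_continuous_on_def
proof (intro allI impI)
  fix e :: real assume e: "e > 0"
  let ?h = "\<lambda>x. f x * cutoff K x"
  have "continuous_on (cball 0 (K + 2)) ?h"
    by (intro continuous_intros continuous_on_subset[OF f]) auto
  then have "uniformly_continuous_on (cball 0 (K + 2)) ?h"
    by (rule compact_uniformly_continuous) simp
  then obtain d where d: "d > 0"
    and D: "\<And>x x'. x \<in> cball 0 (K + 2) \<Longrightarrow> x' \<in> cball 0 (K + 2) \<Longrightarrow> dist x' x < d \<Longrightarrow> dist (?h x') (?h x) < e"
    unfolding uniformly_continuous_on_def using e by metis
  have "dist (?h x') (?h x) < e" if "dist x' x < min d 1" for x x'
  \<comment> \<open>The ball is one unit wider than the support of \<open>cutoff K\<close>: if one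
    of two points at distance below 1 leaves it, both lie outside the support and both values
    vanish.\<close>
  proof (cases "\<bar>x\<bar> \<le> K + 2 \<and> \<bar>x'\<bar> \<le> K + 2")
    case True
    then show ?thesis using D[of x x'] that by simp
  next
    case False
    have "\<bar>x' - x\<bar> < 1" using that by (simp add: dist_real_def)
    then have "\<bar>x\<bar> \<ge> K + 1" "\<bar>x'\<bar> \<ge> K + 1" using False by linarith+
    then show ?thesis using e by (simp add: cutoff_eq_0)
  qed
  then show "\<exists>d>0. \<forall>x\<in>UNIV. \<forall>x'\<in>UNIV. dist x' x < d \<longrightarrow> dist (?h x') (?h x) < e"
    using d by (intro exI[of _ "min d 1"]) auto
qed

lemma bounded_mult_cutoff:
  fixes f :: "real \<Rightarrow> real"
  assumes C: "C > 0" and f: "\<And>x. \<bar>f x\<bar> \<le> C * (1 + x\<^sup>2)" and K: "K \<ge> 0"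
  shows "\<bar>f x * cutoff K x\<bar> \<le> C * (1 + (K + 1)\<^sup>2)"
proof (cases "\<bar>x\<bar> \<le> K + 1")
  case True
  then have "x\<^sup>2 \<le> (K + 1)\<^sup>2" using K abs_le_square_iff[of x "K + 1"] by simp
  have "\<bar>f x * cutoff K x\<bar> \<le> \<bar>f x\<bar> * 1"
    using cutoff_bounds[of K x] by (simp add: abs_mult mult_left_le)
  also have "\<dots> \<le> C * (1 + x\<^sup>2)" using f[of x] by simp
  also have "\<dots> \<le> C * (1 + (K + 1)\<^sup>2)" using \<open>x\<^sup>2 \<le> (K + 1)\<^sup>2\<close> C by simp
  finally show ?thesis .
next
  case False
  then show ?thesis using C by (simp add: cutoff_eq_0)
qed

text \<open>The larger of \<open>\<bar>v\<bar>\<close> and \<open>\<bar>r\<bar>\<close> is at least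
  half of \<open>\<bar>v - r\<bar>\<close>, and the difference vanishes unless the latter exceeds
  \<open>K\<close>. If \<open>v\<close> dominates, \<open>K \<ge> 2 * L\<close> puts it in the tail
  beyond \<open>L\<close>. The constant 8 is 2 from \<open>1 + t^2 \<le> 2 t^2\<close>, by
  \<open>K \<ge> 1\<close>, times 4 from comparing \<open>t^2\<close> with the square of
  \<open>2 * v\<close> or \<open>2 * r\<close>.\<close>

lemma diff_cutoff_le:
  fixes f :: "real \<Rightarrow> real"
  assumes C: "C > 0" and f: "\<And>x. \<bar>f x\<bar> \<le> C * (1 + x\<^sup>2)" and K: "K \<ge> 1" "K \<ge> 2 * L"
  shows "\<bar>f (v - r) - f (v - r) * cutoff K (v - r)\<bar> \<le> 8 * C * (v\<^sup>2 * indicator {x. \<bar>x\<bar> > L} v) + 8 * C * r\<^sup>2"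
proof (cases "\<bar>v - r\<bar> \<le> K")
  case True
  then show ?thesis using C by (simp add: cutoff_eq_1)
next
  case False
  define t where "t = v - r"
  have t: "\<bar>t\<bar> > K" using False by (simp add: t_def)
  have t1: "1 \<le> t\<^sup>2" using t K abs_le_square_iff[of 1 t] by simp
  have "\<bar>f t - f t * cutoff K t\<bar> = \<bar>f t\<bar> * (1 - cutoff K t)"
  proof -
    have "f t - f t * cutoff K t = f t * (1 - cutoff K t)" by (simp add: right_diff_distrib)
    then show ?thesis using cutoff_bounds[of K t] by (simp add: abs_mult)
  qed
  also have "\<dots> \<le> \<bar>f t\<bar> * 1" using cutoff_bounds[of K t] by (intro mult_left_mono) auto
  also have "\<dots> \<le> C * (1 + t\<^sup>2)" using f[of t] by simp
  also have "\<dots> \<le> C * (2 * t\<^sup>2)" using C t1 by simp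
  also have "\<dots> \<le> C * (8 * (v\<^sup>2 * indicator {x. \<bar>x\<bar> > L} v) + 8 * r\<^sup>2)"
  proof (rule mult_left_mono)
    show "2 * t\<^sup>2 \<le> 8 * (v\<^sup>2 * indicator {x. \<bar>x\<bar> > L} v) + 8 * r\<^sup>2"
    proof (cases "\<bar>r\<bar> \<le> \<bar>v\<bar>")
      case True
      then have "\<bar>t\<bar> \<le> \<bar>2 * v\<bar>" by (simp add: t_def)
      then have "t\<^sup>2 \<le> (2 * v)\<^sup>2" by (simp only: abs_le_square_iff)
      then have "2 * t\<^sup>2 \<le> 8 * v\<^sup>2" by (simp add: power_mult_distrib)
      also have "v\<^sup>2 = v\<^sup>2 * indicator {x. \<bar>x\<bar> > L} v" using \<open>\<bar>t\<bar> \<le> \<bar>2 * v\<bar>\<close> t K by simp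
      finally show ?thesis using zero_le_power2[of r] by linarith
    next
      case False
      then have "\<bar>t\<bar> \<le> \<bar>2 * r\<bar>" by (simp add: t_def)
      then have "t\<^sup>2 \<le> (2 * r)\<^sup>2" by (simp only: abs_le_square_iff)
      then have "2 * t\<^sup>2 \<le> 8 * r\<^sup>2" by (simp add: power_mult_distrib)
      moreover have "0 \<le> v\<^sup>2 * indicator {x. \<bar>x\<bar> > L} v" by (simp add: indicator_def)
      ultimately show ?thesis by linarith
    qed
  qed (use C in simp)
  finally show ?thesis by (simp add: t_def algebra_simps)
qed

lemma tendsto_integral_mult_cutoff:
  fixes f :: "real \<Rightarrow> real"
  assumes f: "integrable N f" and N: "sets N = sets borel"
  shows "(\<lambda>k. \<integral>x. f x * cutoff (real k) x \<partial>N) \<longlonglongrightarrow> (\<integral>x. f x \<partial>N)"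
proof (rule integral_dominated_convergence[where w = "\<lambda>x. \<bar>f x\<bar>"])
  have "cutoff K \<in> borel_measurable N" for K
    by (subst measurable_cong_sets[OF N refl]) (intro borel_measurable_continuous_onI continuous_intros)
  then show "(\<lambda>x. f x * cutoff (real k) x) \<in> borel_measurable N" for k using f by auto
  show "AE x in N. (\<lambda>k. f x * cutoff (real k) x) \<longlonglongrightarrow> f x"
  proof (rule AE_I2, rule tendsto_eventually)
    fix x
    show "\<forall>\<^sub>F k in sequentially. f x * cutoff (real k) x = f x"
      using eventually_ge_at_top[of "nat \<lceil>\<bar>x\<bar>\<rceil>"]
      by eventually_elim (simp add: cutoff_eq_1 nat_ceiling_le_eq)
  qed
  show "AE x in N. norm (f x * cutoff (real k) x) \<le> \<bar>f x\<bar>" for k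
    using cutoff_bounds[of "real k"] by (intro AE_I2) (simp add: abs_mult mult_left_le)
qed (use f in auto)

text \<open>A Slutsky theorem for quadratic growth. The function is truncated at
  \<open>V - R\<close>, whose tails are split between those of \<open>V\<close> and the second
  moment of \<open>R\<close>; the perturbation is then removed from the truncated function by
  uniform continuity, and weak convergence is applied to \<open>V\<close> alone.\<close>

lemma (in prob_space) tendsto_expectation_quadratic_growth:
  fixes V R :: "nat \<Rightarrow> 'a \<Rightarrow> real" and f :: "real \<Rightarrow> real"
  assumes V [measurable]: "\<And>n. V n \<in> borel_measurable M" and V2: "\<And>n. integrable M (\<lambda>\<omega>. (V n \<omega>)\<^sup>2)"
    and R [measurable]: "\<And>n. R n \<in> borel_measurable M" and R2: "\<And>n. integrable M (\<lambda>\<omega>. (R n \<omega>)\<^sup>2)"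
    and conv: "\<And>(g :: real \<Rightarrow> real) B. continuous_on UNIV g \<Longrightarrow> (\<And>x. \<bar>g x\<bar> \<le> B)
      \<Longrightarrow> (\<lambda>n. expectation (\<lambda>\<omega>. g (V n \<omega>))) \<longlonglongrightarrow> (\<integral>x. g x \<partial>N)"
    and R0: "(\<lambda>n. expectation (\<lambda>\<omega>. (R n \<omega>)\<^sup>2)) \<longlonglongrightarrow> 0"
    and ui: "\<And>e. e > 0 \<Longrightarrow> \<exists>L. \<forall>n. expectation (\<lambda>\<omega>. (V n \<omega>)\<^sup>2 * indicator {x. \<bar>x\<bar> > L} (V n \<omega>)) \<le> e"
    and N: "prob_space N" "sets N = sets borel" "integrable N (\<lambda>x. x\<^sup>2)"
    and f: "continuous_on UNIV f" and C: "C > 0" and growth: "\<And>x. \<bar>f x\<bar> \<le> C * (1 + x\<^sup>2)"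
  shows "(\<lambda>n. expectation (\<lambda>\<omega>. f (V n \<omega> - R n \<omega>))) \<longlonglongrightarrow> (\<integral>x. f x \<partial>N)"
proof (rule tendstoI)
  interpret N: prob_space N by fact
  fix e0 :: real assume e0: "e0 > 0"
  \<comment> \<open>Error budget: \<open>8 * C * e\<close> from the tail of \<open>V\<close>, and
    one \<open>e\<close> each from uniform continuity, from the terms with the second moment of
    \<open>R\<close>, from weak convergence and from truncating the limit.\<close>
  define e where "e = e0 / (8 * C + 4)"
  have e: "e > 0" "(8 * C + 4) * e = e0" using e0 C by (auto simp: e_def)
  have fb [measurable]: "f \<in> borel_measurable borel" using f by (rule borel_measurable_continuous_onI)
  have fN: "integrable N f"
  proof (rule Bochner_Integration.integrable_bound)
    show "integrable N (\<lambda>x. C * (1 + x\<^sup>2))" using N by simp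
    show "f \<in> borel_measurable N" by (subst measurable_cong_sets[OF N(2) refl]) (rule fb)
    show "AE x in N. norm (f x) \<le> norm (C * (1 + x\<^sup>2))"
      using growth by (auto intro: order_trans[OF _ abs_ge_self])
  qed
  obtain L where L: "\<And>n. expectation (\<lambda>\<omega>. (V n \<omega>)\<^sup>2 * indicator {x. \<bar>x\<bar> > L} (V n \<omega>)) \<le> e"
    using ui e(1) by meson
  have "\<forall>\<^sub>F k in sequentially. dist (\<integral>x. f x * cutoff (real k) x \<partial>N) (\<integral>x. f x \<partial>N) < e"
    using tendsto_integral_mult_cutoff[OF fN N(2)] e(1) by (rule tendstoD)
  then have "\<forall>\<^sub>F k in sequentially. k \<ge> nat \<lceil>max 1 (2 * L)\<rceil> \<and>
      dist (\<integral>x. f x * cutoff (real k) x \<partial>N) (\<integral>x. f x \<partial>N) < e"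
    using eventually_ge_at_top[of "nat \<lceil>max 1 (2 * L)\<rceil>"] by eventually_elim simp
  then obtain k where k: "k \<ge> nat \<lceil>max 1 (2 * L)\<rceil>"
      "dist (\<integral>x. f x * cutoff (real k) x \<partial>N) (\<integral>x. f x \<partial>N) < e"
    using eventually_happens'[OF sequentially_bot] by blast
  define K where "K = real k"
  have "max 1 (2 * L) \<le> K" using k(1) unfolding K_def by (simp add: nat_ceiling_le_eq)
  then have K: "K \<ge> 1" "K \<ge> 2 * L" by auto
  define h where "h x = f x * cutoff K x" for x
  define B where "B = C * (1 + (K + 1)\<^sup>2)"
  have hB: "\<bar>h x\<bar> \<le> B" for x
    unfolding h_def B_def using bounded_mult_cutoff[OF C growth] K by simp
  have B: "B \<ge> 0" using hB[of 0] by simp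
  have huc: "uniformly_continuous_on UNIV h"
    unfolding h_def by (rule uniformly_continuous_mult_cutoff[OF f])
  then have hc: "continuous_on UNIV h" by (rule uniformly_continuous_imp_continuous)
  have [measurable]: "cutoff K \<in> borel_measurable borel"
    by (intro borel_measurable_continuous_onI continuous_intros)
  from hc have hb [measurable]: "h \<in> borel_measurable borel" by (rule borel_measurable_continuous_onI)
  obtain d where d: "d > 0" and D: "\<And>x x'. \<bar>x' - x\<bar> < d \<Longrightarrow> \<bar>h x' - h x\<bar> < e"
    using huc e(1) unfolding uniformly_continuous_on_def dist_real_def by (metis UNIV_I)
  \<comment> \<open>Chebyshev's device: where \<open>\<bar>r\<bar> \<ge> d\<close>, the trivial
    bound \<open>2 * B\<close> is at most \<open>b * r^2\<close>.\<close>
  define b where "b = 2 * B / d\<^sup>2"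
  have h_diff: "\<bar>h (v - r) - h v\<bar> \<le> e + b * r\<^sup>2" for v r
  proof (cases "\<bar>r\<bar> < d")
    case True
    then have "\<bar>h (v - r) - h v\<bar> < e" by (intro D) simp
    moreover have "b * r\<^sup>2 \<ge> 0" using B by (simp add: b_def)
    ultimately show ?thesis by linarith
  next
    case False
    then have "d\<^sup>2 \<le> r\<^sup>2" using d abs_le_square_iff[of d r] by simp
    have "\<bar>h (v - r) - h v\<bar> \<le> 2 * B" using hB[of v] hB[of "v - r"] by linarith
    also have "\<dots> = b * d\<^sup>2" using d by (simp add: b_def)
    also have "\<dots> \<le> b * r\<^sup>2" using \<open>d\<^sup>2 \<le> r\<^sup>2\<close> B by (intro mult_left_mono) (auto simp: b_def)
    finally show ?thesis using e by simp
  qed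
  have lim: "(\<lambda>n. (8 * C + b) * expectation (\<lambda>\<omega>. (R n \<omega>)\<^sup>2)) \<longlonglongrightarrow> 0"
    using tendsto_mult_left[OF R0, of "8 * C + b"] by simp
  have "\<forall>\<^sub>F n in sequentially. dist (expectation (\<lambda>\<omega>. h (V n \<omega>))) (\<integral>x. h x \<partial>N) < e"
    using conv[OF hc hB] e(1) by (rule tendstoD)
  moreover have "\<forall>\<^sub>F n in sequentially. (8 * C + b) * expectation (\<lambda>\<omega>. (R n \<omega>)\<^sup>2) < e"
    using lim e(1) by (rule order_tendstoD)
  ultimately show "\<forall>\<^sub>F n in sequentially. dist (expectation (\<lambda>\<omega>. f (V n \<omega> - R n \<omega>))) (\<integral>x. f x \<partial>N) < e0"
  proof eventually_elim
    case (elim n)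
    let ?T = "\<lambda>\<omega>. V n \<omega> - R n \<omega>"
    let ?r = "expectation (\<lambda>\<omega>. (R n \<omega>)\<^sup>2)"
    let ?I = "\<lambda>\<omega>. (V n \<omega>)\<^sup>2 * indicator {x. \<bar>x\<bar> > L} (V n \<omega>) :: real"
    have intI: "integrable M ?I"
      by (rule Bochner_Integration.integrable_bound[OF V2[of n]]) (auto simp: indicator_def)
    have hT: "integrable M (\<lambda>\<omega>. h (?T \<omega>))" "integrable M (\<lambda>\<omega>. h (V n \<omega>))"
      by (rule integrable_const_bound[where B = B]; auto simp: hB)+
    have fdiff: "integrable M (\<lambda>\<omega>. f (?T \<omega>) - h (?T \<omega>))"
      by (rule Bochner_Integration.integrable_bound[where f = "\<lambda>\<omega>. 8 * C * ?I \<omega> + 8 * C * (R n \<omega>)\<^sup>2"])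
        (use intI R2 diff_cutoff_le[OF C growth K] in \<open>auto simp: h_def intro!: order_trans[OF _ abs_ge_self]\<close>)
    have fT: "integrable M (\<lambda>\<omega>. f (?T \<omega>))"
      using Bochner_Integration.integrable_add[OF fdiff hT(1)] by simp
    have "\<bar>expectation (\<lambda>\<omega>. f (?T \<omega>)) - expectation (\<lambda>\<omega>. h (?T \<omega>))\<bar>
        = \<bar>expectation (\<lambda>\<omega>. f (?T \<omega>) - h (?T \<omega>))\<bar>" using fT hT by simp
    also have "\<dots> \<le> expectation (\<lambda>\<omega>. \<bar>f (?T \<omega>) - h (?T \<omega>)\<bar>)" by (rule integral_abs_bound)
    also have "\<dots> \<le> expectation (\<lambda>\<omega>. 8 * C * ?I \<omega> + 8 * C * (R n \<omega>)\<^sup>2)"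
      using intI R2 fdiff diff_cutoff_le[OF C growth K] by (intro integral_mono) (auto simp: h_def)
    also have "\<dots> = 8 * C * expectation ?I + 8 * C * ?r" using intI R2 by simp
    also have "\<dots> \<le> 8 * C * e + 8 * C * ?r" using L[of n] C by simp
    finally have 1: "\<bar>expectation (\<lambda>\<omega>. f (?T \<omega>)) - expectation (\<lambda>\<omega>. h (?T \<omega>))\<bar> \<le> 8 * C * e + 8 * C * ?r" .
    have "\<bar>expectation (\<lambda>\<omega>. h (?T \<omega>)) - expectation (\<lambda>\<omega>. h (V n \<omega>))\<bar>
        = \<bar>expectation (\<lambda>\<omega>. h (?T \<omega>) - h (V n \<omega>))\<bar>" using hT by simp
    also have "\<dots> \<le> expectation (\<lambda>\<omega>. \<bar>h (?T \<omega>) - h (V n \<omega>)\<bar>)" by (rule integral_abs_bound)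
    also have "\<dots> \<le> expectation (\<lambda>\<omega>. e + b * (R n \<omega>)\<^sup>2)"
      using hT R2 by (intro integral_mono h_diff) auto
    also have "\<dots> = e + b * ?r" using R2 by (simp add: prob_space)
    finally have 2: "\<bar>expectation (\<lambda>\<omega>. h (?T \<omega>)) - expectation (\<lambda>\<omega>. h (V n \<omega>))\<bar> \<le> e + b * ?r" .
    have 3: "\<bar>(\<integral>x. h x \<partial>N) - (\<integral>x. f x \<partial>N)\<bar> < e"
      using k(2) by (simp add: h_def K_def dist_real_def)
    have "(8 * C + 4) * e = 8 * C * e + 4 * e" "(8 * C + b) * ?r = 8 * C * ?r + b * ?r"
      by (simp_all add: algebra_simps)
    then show ?case
      using 1 2 3 elim e(2) unfolding dist_real_def by linarith
  qed
qed

subsection \<open>Resampling from an iid sequence\<close>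

lemma integral_pair_pmf_finite:
  fixes h :: "'s \<Rightarrow> 't \<Rightarrow> real"
  assumes "finite (set_pmf p)" "finite (set_pmf q)"
  shows "(\<integral>s. h (fst s) (snd s) \<partial>measure_pmf (pair_pmf p q)) = (\<integral>a. \<integral>b. h a b \<partial>measure_pmf q \<partial>measure_pmf p)"
proof -
  have "(\<integral>s. h (fst s) (snd s) \<partial>measure_pmf (pair_pmf p q))
      = (\<Sum>(a, b)\<in>set_pmf p \<times> set_pmf q. pmf p a * pmf q b * h a b)"
    using assms by (subst integral_pmf_finite) (auto simp: pmf_pair case_prod_beta intro!: sum.cong)
  also have "\<dots> = (\<Sum>a\<in>set_pmf p. pmf p a * (\<Sum>b\<in>set_pmf q. pmf q b * h a b))"
    by (simp add: sum.cartesian_product[symmetric] sum_distrib_left mult.assoc)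
  finally show ?thesis using assms by (simp add: integral_pmf_finite)
qed

text \<open>The correlation with its tie-breaker averaged out. For a uniform \<open>p\<close> it is
  the kernel of the U-statistic formed by the conditional expectation of the resample
  correlation.\<close>

definition mean_xi :: "real \<Rightarrow> nat list pmf \<Rightarrow> (real \<times> real) list \<Rightarrow> real" where
  "mean_xi c p zs = (\<integral>t. chatterjee_xi c t zs \<partial>measure_pmf p)"

definition xi_bound :: "real \<Rightarrow> nat list \<Rightarrow> nat list \<Rightarrow> real" where
  "xi_bound c t js = \<bar>c\<bar> + 1 + (3 + real (length js)) * (real (length js) * real (length t))"

section \<open>An iid sequence observed along fixed index lists\<close>

locale iid_pairs = prob_space M for M :: "'a measure" +
  fixes D :: "nat \<Rightarrow> 'a \<Rightarrow> real \<times> real" and \<mu> :: "(real \<times> real) measure"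
  assumes indep: "indep_vars (\<lambda>_. borel) D UNIV"
    and law: "\<And>k. distr M borel (D k) = \<mu>"
begin

lemma measurable_D [measurable]: "D k \<in> borel_measurable M"
  using indep unfolding indep_vars_def by auto

text \<open>The sequence has the infinite product of \<mu> as its law, and reindexing along the
  injective map \<open>(!) js\<close> projects it onto a finite power of \<mu>.\<close>

lemma distr_distinct:
  assumes js: "distinct js"
  shows "distr M (\<Pi>\<^sub>M i\<in>{..<length js}. borel) (\<lambda>\<omega>. \<lambda>i\<in>{..<length js}. D (js ! i) \<omega>)
    = (\<Pi>\<^sub>M i\<in>{..<length js}. \<mu>)"
proof -
  have \<mu>: "prob_space \<mu>" unfolding law[of 0, symmetric] by (rule prob_space_distr) simp
  have sets_\<mu>: "sets \<mu> = sets borel" unfolding law[of 0, symmetric] by simp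
  have sets_PiM: "sets (\<Pi>\<^sub>M i\<in>I. \<mu>) = sets (\<Pi>\<^sub>M i\<in>I. borel)" for I :: "nat set"
    by (rule sets_PiM_cong) (auto simp: sets_\<mu>)
  have meas: "(\<lambda>\<omega> i. D i \<omega>) \<in> measurable M (\<Pi>\<^sub>M i\<in>UNIV. borel)"
    using measurable_restrict[of UNIV D M "\<lambda>_. borel"] by (simp add: restrict_def)
  have reindex: "(\<lambda>x. \<lambda>i\<in>{..<length js}. x (js ! i)) \<in> measurable (\<Pi>\<^sub>M i\<in>UNIV. borel :: (real \<times> real) measure) (\<Pi>\<^sub>M i\<in>{..<length js}. borel)"
    by (rule measurable_restrict) simp
  have "distr M (\<Pi>\<^sub>M i\<in>UNIV. borel) (\<lambda>\<omega>. \<lambda>i\<in>UNIV. D i \<omega>) = (\<Pi>\<^sub>M i\<in>UNIV. distr M borel (D i))"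
    using indep by (subst indep_vars_iff_distr_eq_PiM[symmetric]) auto
  then have joint: "distr M (\<Pi>\<^sub>M i\<in>UNIV. borel) (\<lambda>\<omega> i. D i \<omega>) = (\<Pi>\<^sub>M i\<in>UNIV. \<mu>)"
    by (simp add: law restrict_def)
  have "distr M (\<Pi>\<^sub>M i\<in>{..<length js}. borel) (\<lambda>\<omega>. \<lambda>i\<in>{..<length js}. D (js ! i) \<omega>)
      = distr (\<Pi>\<^sub>M i\<in>UNIV. \<mu>) (\<Pi>\<^sub>M i\<in>{..<length js}. borel) (\<lambda>x. \<lambda>i\<in>{..<length js}. x (js ! i))"
    unfolding joint[symmetric] by (subst distr_distr[OF reindex meas]) (simp add: comp_def)
  also have "\<dots> = distr (\<Pi>\<^sub>M i\<in>UNIV. \<mu>) (\<Pi>\<^sub>M i\<in>{..<length js}. \<mu>) (\<lambda>x. \<lambda>i\<in>{..<length js}. x (js ! i))"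
    by (rule distr_cong) (auto simp: sets_PiM)
  also have "\<dots> = (\<Pi>\<^sub>M i\<in>{..<length js}. \<mu>)"
    using js by (intro distr_PiM_reindex) (auto simp: \<mu> inj_on_nth)
  finally show ?thesis .
qed

text \<open>Both sides are the same integral over a power of \<mu>, as a list of distinct indices,
  in whatever order, selects iid observations.\<close>

lemma expectation_resample:
  fixes H :: "(real \<times> real) list \<Rightarrow> real"
  assumes js: "distinct js" and n: "n = length js"
    and H: "(\<lambda>x. H (map x [0..<n])) \<in> borel_measurable (\<Pi>\<^sub>M i\<in>{..<n}. borel)"
  shows "expectation (\<lambda>\<omega>. H (resample D js \<omega>)) = expectation (\<lambda>\<omega>. H (sample D n \<omega>))"
proof -
  have *: "expectation (\<lambda>\<omega>. H (map (\<lambda>j. D j \<omega>) ks)) = (\<integral>x. H (map x [0..<n]) \<partial>(\<Pi>\<^sub>M i\<in>{..<n}. \<mu>))"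
    if ks: "distinct ks" "length ks = n" for ks
  proof -
    have m: "(\<lambda>\<omega>. \<lambda>i\<in>{..<n}. D (ks ! i) \<omega>) \<in> measurable M (\<Pi>\<^sub>M i\<in>{..<n}. borel)"
      by (rule measurable_restrict) simp
    have "map (\<lambda>i\<in>{..<n}. D (ks ! i) \<omega>) [0..<n] = map (\<lambda>j. D j \<omega>) ks" for \<omega>
      using ks by (intro nth_equalityI) auto
    then have "expectation (\<lambda>\<omega>. H (map (\<lambda>j. D j \<omega>) ks))
        = expectation (\<lambda>\<omega>. H (map (\<lambda>i\<in>{..<n}. D (ks ! i) \<omega>) [0..<n]))" by simp
    also have "\<dots> = (\<integral>x. H (map x [0..<n]) \<partial>distr M (\<Pi>\<^sub>M i\<in>{..<n}. borel) (\<lambda>\<omega>. \<lambda>i\<in>{..<n}. D (ks ! i) \<omega>))"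
      by (rule integral_distr[OF m H, symmetric])
    finally show ?thesis using distr_distinct[OF ks(1)] ks(2) by simp
  qed
  show ?thesis unfolding resample_def sample_def using *[of js] *[of "[0..<n]"] js n by simp
qed

text \<open>Disjoint index sets pick independent families; this yields the orthogonality that the
  block argument asks for.\<close>

lemma expectation_mult_resample:
  fixes H K :: "(real \<times> real) list \<Rightarrow> real"
  assumes disj: "set js \<inter> set ks = {}"
    and H: "(\<lambda>x. H (map x js)) \<in> borel_measurable (\<Pi>\<^sub>M i\<in>set js. borel)"
    and K: "(\<lambda>x. K (map x ks)) \<in> borel_measurable (\<Pi>\<^sub>M i\<in>set ks. borel)"
    and int: "integrable M (\<lambda>\<omega>. H (resample D js \<omega>))" "integrable M (\<lambda>\<omega>. K (resample D ks \<omega>))"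
  shows "expectation (\<lambda>\<omega>. H (resample D js \<omega>) * K (resample D ks \<omega>))
    = expectation (\<lambda>\<omega>. H (resample D js \<omega>)) * expectation (\<lambda>\<omega>. K (resample D ks \<omega>))"
proof -
  have "indep_var borel ((\<lambda>x. H (map x js)) \<circ> (\<lambda>\<omega>. \<lambda>i\<in>set js. D i \<omega>))
      borel ((\<lambda>x. K (map x ks)) \<circ> (\<lambda>\<omega>. \<lambda>i\<in>set ks. D i \<omega>))"
    by (rule indep_var_compose[OF indep_var_restrict[OF indep disj] H K]) auto
  moreover have "map (\<lambda>i\<in>set ls. D i \<omega>) ls = resample D ls \<omega>" for ls \<omega>
    by (simp add: resample_def)
  ultimately have "indep_var borel (\<lambda>\<omega>. H (resample D js \<omega>)) borel (\<lambda>\<omega>. K (resample D ks \<omega>))"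
    by (simp add: comp_def)
  then show ?thesis using int by (rule indep_var_lebesgue_integral)
qed

lemma measurable_chatterjee_xi_coordinates:
  "set js \<subseteq> I \<Longrightarrow> (\<lambda>x. chatterjee_xi c t (map x js)) \<in> borel_measurable (\<Pi>\<^sub>M i\<in>I. borel)"
  by (rule measurable_chatterjee_xi[where D = "\<lambda>i x. x i"]) (auto intro: measurable_component_singleton)

lemma measurable_chatterjee_xi_resample [measurable]:
  "(\<lambda>\<omega>. chatterjee_xi c t (resample D js \<omega>)) \<in> borel_measurable M"
  unfolding resample_def by (rule measurable_chatterjee_xi) simp

lemma length_resample: "length (resample D js \<omega>) = length js"
  by (simp add: resample_def)

lemma sample_eq_resample: "sample D n = resample D [0..<n]"
  by (simp add: fun_eq_iff sample_def resample_def)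

lemma chatterjee_xi_resample_bound: "\<bar>chatterjee_xi c t (resample D js \<omega>)\<bar> \<le> xi_bound c t js"
  using chatterjee_xi_bound[of c t "resample D js \<omega>"] by (simp add: xi_bound_def length_resample)

lemma integrable_chatterjee_xi: "integrable M (\<lambda>\<omega>. chatterjee_xi c t (resample D js \<omega>))"
  by (rule integrable_const_bound[where B = "xi_bound c t js"]) (auto simp: chatterjee_xi_resample_bound)

lemma integrable_chatterjee_xi_mult:
  "integrable M (\<lambda>\<omega>. (chatterjee_xi c t (resample D js \<omega>) - a) * (chatterjee_xi c s (resample D ks \<omega>) - b))"
proof -
  have u': "\<bar>chatterjee_xi c t (resample D js \<omega>) - a\<bar> \<le> xi_bound c t js + \<bar>a\<bar>" for a t js \<omega>
    using chatterjee_xi_resample_bound[of c t js \<omega>] by linarith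
  show ?thesis
    by (rule integrable_const_bound[where B = "(xi_bound c t js + \<bar>a\<bar>) * (xi_bound c s ks + \<bar>b\<bar>)"])
      (auto simp: abs_mult intro!: mult_mono u' order_trans[OF abs_ge_zero u'])
qed

text \<open>The kernel \<open>mean_xi\<close>, centred at \<open>e\<close>, has mean zero and is
  uncorrelated over disjoint draws, which is the situation of the block argument. The bound is
  phrased with the randomised correlation and not with its average because the second moment of
  \<open>T\<close> appears in that form.\<close>

lemma second_moment_mean_xi:
  fixes p :: "nat list pmf"
  assumes m: "0 < m" "m \<le> n" and p: "finite (set_pmf p)"
    and e: "e = expectation (\<lambda>\<omega>. mean_xi c p (sample D m \<omega>))"
  shows "expectation (\<lambda>\<omega>. ((\<Sum>js\<in>draws m n. mean_xi c p (resample D js \<omega>) - e) / card (draws m n))\<^sup>2)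
    \<le> (\<integral>t. expectation (\<lambda>\<omega>. (chatterjee_xi c t (sample D m \<omega>) - e)\<^sup>2) \<partial>measure_pmf p) / real (n div m)"
proof (rule second_moment_average_draws[OF m])
  note eq = integral_pmf_finite[OF p]
  have p1: "(\<Sum>t\<in>set_pmf p. pmf p t) = 1" by (rule sum_pmf_eq_1[OF p]) simp
  \<comment> \<open>As the weights sum to 1, the centring moves inside the average over
    tie-breakers.\<close>
  have g: "mean_xi c p zs - e = (\<Sum>t\<in>set_pmf p. pmf p t * (chatterjee_xi c t zs - e))" for zs
    using p1 by (simp add: mean_xi_def eq right_diff_distrib sum_subtractf sum_distrib_right[symmetric])
  have meas: "(\<lambda>x. mean_xi c p (map x js) - e) \<in> borel_measurable (\<Pi>\<^sub>M i\<in>I. borel)" if "set js \<subseteq> I" for js and I :: "nat set"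
    unfolding g using measurable_chatterjee_xi_coordinates[OF that] by simp
  have int: "integrable M (\<lambda>\<omega>. mean_xi c p (resample D js \<omega>) - e)" for js
    unfolding g using integrable_chatterjee_xi by simp
  show int2: "integrable M (\<lambda>\<omega>. (mean_xi c p (resample D js \<omega>) - e) * (mean_xi c p (resample D ks \<omega>) - e))" for js ks
  proof -
    have "(mean_xi c p (resample D js \<omega>) - e) * (mean_xi c p (resample D ks \<omega>) - e)
        = (\<Sum>t\<in>set_pmf p. \<Sum>s\<in>set_pmf p. pmf p t * pmf p s *
            ((chatterjee_xi c t (resample D js \<omega>) - e) * (chatterjee_xi c s (resample D ks \<omega>) - e)))" for \<omega>
      unfolding g sum_product by (simp add: mult_ac)
    then show ?thesis
      by (simp only:) (intro Bochner_Integration.integrable_sum integrable_mult_right integrable_chatterjee_xi_mult)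
  qed
  have same: "expectation (\<lambda>\<omega>. H (resample D js \<omega>)) = expectation (\<lambda>\<omega>. H (sample D m \<omega>))"
    if "js \<in> draws m n" "(\<lambda>x. H (map x [0..<m])) \<in> borel_measurable (\<Pi>\<^sub>M i\<in>{..<m}. borel)" for js and H :: "_ \<Rightarrow> real"
    using that by (intro expectation_resample) (auto simp: draws_def)
  have mean0: "expectation (\<lambda>\<omega>. mean_xi c p (resample D js \<omega>) - e) = 0" if js: "js \<in> draws m n" for js
  proof -
    have "expectation (\<lambda>\<omega>. mean_xi c p (resample D js \<omega>) - e) = expectation (\<lambda>\<omega>. mean_xi c p (sample D m \<omega>) - e)"
      using js meas[of "[0..<m]" "{..<m}"]
      by (intro same[of js "\<lambda>zs. mean_xi c p zs - e"]) (auto simp: lessThan_atLeast0)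
    also have "integrable M (\<lambda>\<omega>. mean_xi c p (sample D m \<omega>))"
      using Bochner_Integration.integrable_add[OF int[of "[0..<m]"] integrable_const[of e]] by (simp add: sample_eq_resample)
    then have "expectation (\<lambda>\<omega>. mean_xi c p (sample D m \<omega>) - e) = 0"
      by (simp add: e prob_space)
    finally show ?thesis .
  qed
  show "expectation (\<lambda>\<omega>. (mean_xi c p (resample D js \<omega>) - e) * (mean_xi c p (resample D ks \<omega>) - e)) = 0"
    if "js \<in> draws m n" "ks \<in> draws m n" "set js \<inter> set ks = {}" for js ks
    using expectation_mult_resample[OF that(3), of "\<lambda>zs. mean_xi c p zs - e" "\<lambda>zs. mean_xi c p zs - e"]
      meas int mean0[OF that(1)] by simp
  fix js assume js: "js \<in> draws m n"
  \<comment> \<open>Jensen's inequality for the average over tie-breakers.\<close>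
  have sq: "(mean_xi c p zs - e)\<^sup>2 \<le> (\<Sum>t\<in>set_pmf p. pmf p t * (chatterjee_xi c t zs - e)\<^sup>2)" for zs
    unfolding g using convex_on_sum[OF p set_pmf_not_empty convex_power2 p1, of "\<lambda>t. chatterjee_xi c t zs - e"]
    by simp
  have intc: "integrable M (\<lambda>\<omega>. (chatterjee_xi c t (resample D ks \<omega>) - e)\<^sup>2)" for t ks
    unfolding power2_eq_square by (rule integrable_chatterjee_xi_mult)
  have "expectation (\<lambda>\<omega>. (mean_xi c p (resample D js \<omega>) - e)\<^sup>2)
      \<le> expectation (\<lambda>\<omega>. \<Sum>t\<in>set_pmf p. pmf p t * (chatterjee_xi c t (resample D js \<omega>) - e)\<^sup>2)"
    using int2[of js js] intc by (intro integral_mono sq) (auto simp: power2_eq_square)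
  also have "\<dots> = (\<Sum>t\<in>set_pmf p. pmf p t * expectation (\<lambda>\<omega>. (chatterjee_xi c t (resample D js \<omega>) - e)\<^sup>2))"
    using intc by simp
  also have "\<dots> = (\<Sum>t\<in>set_pmf p. pmf p t * expectation (\<lambda>\<omega>. (chatterjee_xi c t (sample D m \<omega>) - e)\<^sup>2))"
    using js measurable_chatterjee_xi_coordinates[of "[0..<m]" "{..<m}"]
    by (intro sum.cong refl arg_cong2[where f = "(*)"] same[of js "\<lambda>zs. (chatterjee_xi c _ zs - e)\<^sup>2"])
      (auto simp: lessThan_atLeast0)
  finally show "expectation (\<lambda>\<omega>. (mean_xi c p (resample D js \<omega>) - e)\<^sup>2)
      \<le> (\<integral>t. expectation (\<lambda>\<omega>. (chatterjee_xi c t (sample D m \<omega>) - e)\<^sup>2) \<partial>measure_pmf p)"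
    by (simp add: eq)
qed

end

section \<open>Algebras generated by the data, and integrals under the auxiliary law\<close>

lemma space_seq_algebra [simp]: "space (seq_algebra M D) = space M"
  by (simp add: seq_algebra_def)

lemma space_sample_algebra [simp]: "space (sample_algebra M D n) = space M"
  by (simp add: sample_algebra_def)

lemma measurable_seq_algebra: "D k \<in> measurable (seq_algebra M D) borel"
proof -
  have "(\<lambda>\<omega> i. D i \<omega>) \<in> measurable (seq_algebra M D) (\<Pi>\<^sub>M i\<in>UNIV. borel)"
    unfolding seq_algebra_def by (rule measurable_vimage_algebra1) (auto simp: space_PiM)
  from measurable_compose[OF this measurable_component_singleton[of k]] show ?thesis by simp
qed

lemma measurable_sample_algebra: "k < n \<Longrightarrow> D k \<in> measurable (sample_algebra M D n) borel"
proof -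
  assume k: "k < n"
  have "(\<lambda>\<omega>. \<lambda>i\<in>{..<n}. D i \<omega>) \<in> measurable (sample_algebra M D n) (\<Pi>\<^sub>M i\<in>{..<n}. borel)"
    unfolding sample_algebra_def by (rule measurable_vimage_algebra1) (auto simp: space_PiM)
  from measurable_compose[OF this measurable_component_singleton[of k]] k show ?thesis by simp
qed

lemma subalgebra_sample_algebra: "subalgebra (seq_algebra M D) (sample_algebra M D n)"
  unfolding subalgebra_def
proof
  show "sets (sample_algebra M D n) \<subseteq> sets (seq_algebra M D)"
    unfolding sample_algebra_def
    by (rule sets_image_in_sets) (auto intro!: measurable_restrict measurable_seq_algebra)
qed simp

lemma set_pmf_draws [simp]: "k \<le> n \<Longrightarrow> set_pmf (pmf_of_set (draws k n)) = draws k n"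
  by (simp add: set_pmf_of_set draws_nonempty)

lemma finite_set_pmf_aux_law: "k \<le> n \<Longrightarrow> finite (set_pmf (aux_law k n))"
  by (simp add: aux_law_def set_pmf_of_set draws_nonempty)

lemma finite_set_pmf_permutations: "finite (set_pmf (pmf_of_set (permutations_of_set {..<k::nat})))"
  by (simp add: set_pmf_of_set)

lemma integral_aux_law:
  fixes h :: "nat list \<Rightarrow> nat list \<Rightarrow> real"
  assumes "k \<le> n"
  shows "(\<integral>s. h (fst (snd s)) (snd (snd s)) \<partial>measure_pmf (aux_law k n))
    = (\<Sum>js\<in>draws k n. \<integral>t. h js t \<partial>measure_pmf (pmf_of_set (permutations_of_set {..<k}))) / card (draws k n)"
proof -
  note fin = finite_set_pmf_permutations
  have "finite (set_pmf (pair_pmf (pmf_of_set (draws k n)) (pmf_of_set (permutations_of_set {..<k}))))"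
    using assms by (simp add: set_pmf_of_set draws_nonempty)
  from integral_pair_pmf_finite[OF fin[of n] this, of "\<lambda>_ s. h (fst s) (snd s)"]
  have "(\<integral>s. h (fst (snd s)) (snd (snd s)) \<partial>measure_pmf (aux_law k n))
    = (\<integral>s. h (fst s) (snd s) \<partial>measure_pmf (pair_pmf (pmf_of_set (draws k n)) (pmf_of_set (permutations_of_set {..<k}))))"
    by (simp add: aux_law_def)
  also have "\<dots> = (\<integral>js. \<integral>t. h js t \<partial>measure_pmf (pmf_of_set (permutations_of_set {..<k})) \<partial>measure_pmf (pmf_of_set (draws k n)))"
    using assms by (intro integral_pair_pmf_finite fin) (simp add: set_pmf_of_set draws_nonempty)
  finally show ?thesis
    using integral_pmf_of_set[OF draws_nonempty[OF assms] finite_draws] by simp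
qed

lemma integral_aux_law_fst:
  fixes h :: "nat list \<Rightarrow> real"
  assumes "k \<le> n"
  shows "(\<integral>s. h (fst s) \<partial>measure_pmf (aux_law k n)) = (\<integral>t. h t \<partial>measure_pmf (pmf_of_set (permutations_of_set {..<n})))"
proof -
  have "finite (set_pmf (pair_pmf (pmf_of_set (draws k n)) (pmf_of_set (permutations_of_set {..<k}))))"
    using assms by (simp add: set_pmf_of_set draws_nonempty)
  from integral_pair_pmf_finite[OF finite_set_pmf_permutations[of n] this, of "\<lambda>t _. h t"]
  show ?thesis by (simp add: aux_law_def)
qed

section \<open>Random indices and tie-breakers at one sample size\<close>

locale resampling = iid_pairs M D \<mu> for M :: "'a measure" and D \<mu> +
  fixes k n :: nat and S :: "'a \<Rightarrow> nat list \<times> nat list \<times> nat list"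
  assumes kn: "k \<le> n"
    and S: "S \<in> measurable M (count_space UNIV)"
    and S_law: "distr M (count_space UNIV) S = measure_pmf (aux_law k n)"
    and S_indep: "indep_set (sets (seq_algebra M D)) (sets (vimage_algebra (space M) S (count_space UNIV)))"
begin

text \<open>\<open>T\<close> and \<open>I\<close> read a tie-breaker and an index list off the
  auxiliary value, so the sample and the resample are covered at once. Quadratic growth of
  \<open>\<psi>\<close> admits the identity, the square, truncated squares and bounded
  functions.\<close>

lemma expectation_chatterjee_xi:
  fixes \<psi> :: "real \<Rightarrow> real"
  assumes \<psi> [measurable]: "\<psi> \<in> borel_measurable borel" and growth: "\<And>x. \<bar>\<psi> x\<bar> \<le> b * (1 + x\<^sup>2)"
  shows "expectation (\<lambda>\<omega>. \<psi> (a * (chatterjee_xi c (T (S \<omega>)) (resample D (I (S \<omega>)) \<omega>) - e)))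
      = (\<integral>s. expectation (\<lambda>\<omega>. \<psi> (a * (chatterjee_xi c (T s) (resample D (I s) \<omega>) - e))) \<partial>measure_pmf (aux_law k n))"
    and "integrable M (\<lambda>\<omega>. \<psi> (a * (chatterjee_xi c (T (S \<omega>)) (resample D (I (S \<omega>)) \<omega>) - e)))"
proof -
  have b: "0 \<le> b" using growth[of 0] by simp
  define u where "u s = b * (1 + (\<bar>a\<bar> * (xi_bound c (T s) (I s) + \<bar>e\<bar>))\<^sup>2)" for s
  have u: "\<bar>\<psi> (a * (chatterjee_xi c (T s) (resample D (I s) \<omega>) - e))\<bar> \<le> u s" for s \<omega>
  proof -
    let ?x = "chatterjee_xi c (T s) (resample D (I s) \<omega>)"
    have "\<bar>?x - e\<bar> \<le> xi_bound c (T s) (I s) + \<bar>e\<bar>"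
      using chatterjee_xi_resample_bound[of c "T s" "I s" \<omega>] by linarith
    then have "\<bar>a * (?x - e)\<bar> \<le> \<bar>a\<bar> * (xi_bound c (T s) (I s) + \<bar>e\<bar>)"
      by (simp add: abs_mult mult_left_mono)
    then have "(a * (?x - e))\<^sup>2 \<le> (\<bar>a\<bar> * (xi_bound c (T s) (I s) + \<bar>e\<bar>))\<^sup>2"
      using abs_le_square_iff by fastforce
    then have "b * (1 + (a * (?x - e))\<^sup>2) \<le> u s" unfolding u_def using b by (intro mult_left_mono) auto
    then show ?thesis using growth[of "a * (?x - e)"] by linarith
  qed
  have [measurable]: "(\<lambda>\<omega>. chatterjee_xi c (T s) (resample D (I s) \<omega>)) \<in> borel_measurable (seq_algebra M D)" for s
    unfolding resample_def by (rule measurable_chatterjee_xi) (rule measurable_seq_algebra)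
  have m: "(\<lambda>\<omega>. \<psi> (a * (chatterjee_xi c (T s) (resample D (I s) \<omega>) - e))) \<in> borel_measurable (seq_algebra M D)" for s
    by simp
  note mix = expectation_indep_pmf[OF S S_law finite_set_pmf_aux_law[OF kn] space_seq_algebra S_indep m u]
  show "expectation (\<lambda>\<omega>. \<psi> (a * (chatterjee_xi c (T (S \<omega>)) (resample D (I (S \<omega>)) \<omega>) - e)))
      = (\<integral>s. expectation (\<lambda>\<omega>. \<psi> (a * (chatterjee_xi c (T s) (resample D (I s) \<omega>) - e))) \<partial>measure_pmf (aux_law k n))"
    by (rule mix(1))
  show "integrable M (\<lambda>\<omega>. \<psi> (a * (chatterjee_xi c (T (S \<omega>)) (resample D (I (S \<omega>)) \<omega>) - e)))"
    by (rule mix(2))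
qed

lemma expectation_xi_sample:
  fixes \<psi> :: "real \<Rightarrow> real"
  assumes "\<psi> \<in> borel_measurable borel" "\<And>x. \<bar>\<psi> x\<bar> \<le> b * (1 + x\<^sup>2)"
  shows "expectation (\<lambda>\<omega>. \<psi> (a * (chatterjee_xi c (fst (S \<omega>)) (sample D l \<omega>) - e)))
      = (\<integral>t. expectation (\<lambda>\<omega>. \<psi> (a * (chatterjee_xi c t (sample D l \<omega>) - e)))
          \<partial>measure_pmf (pmf_of_set (permutations_of_set {..<n})))"
    and "integrable M (\<lambda>\<omega>. \<psi> (a * (chatterjee_xi c (fst (S \<omega>)) (sample D l \<omega>) - e)))"
  using expectation_chatterjee_xi[OF assms, where T = fst and I = "\<lambda>_. [0..<l]"]
    integral_aux_law_fst[OF kn, of "\<lambda>t. expectation (\<lambda>\<omega>. \<psi> (a * (chatterjee_xi c t (sample D l \<omega>) - e)))"]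
  unfolding sample_eq_resample[symmetric] by auto

text \<open>For fixed indices the expectation does not depend on the draw, so averaging over the
  draws has no effect. The right-hand side is the value that \<open>expectation_xi_sample\<close>
  gives for a sample of size \<open>k\<close> with its own tie-breaker.\<close>

lemma expectation_xi_resample:
  fixes \<psi> :: "real \<Rightarrow> real"
  assumes \<psi>: "\<psi> \<in> borel_measurable borel" "\<And>x. \<bar>\<psi> x\<bar> \<le> b * (1 + x\<^sup>2)"
  shows "expectation (\<lambda>\<omega>. \<psi> (a * (chatterjee_xi c (snd (snd (S \<omega>))) (resample D (fst (snd (S \<omega>))) \<omega>) - e)))
      = (\<integral>t. expectation (\<lambda>\<omega>. \<psi> (a * (chatterjee_xi c t (sample D k \<omega>) - e)))
          \<partial>measure_pmf (pmf_of_set (permutations_of_set {..<k})))"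
proof -
  have same: "expectation (\<lambda>\<omega>. \<psi> (a * (chatterjee_xi c t (resample D js \<omega>) - e)))
      = expectation (\<lambda>\<omega>. \<psi> (a * (chatterjee_xi c t (sample D k \<omega>) - e)))" if "js \<in> draws k n" for js t
    using that \<psi>(1) measurable_chatterjee_xi_coordinates[of "[0..<k]" "{..<k}" c t]
    by (intro expectation_resample[where H = "\<lambda>zs. \<psi> (a * (chatterjee_xi c t zs - e))"])
       (auto simp: draws_def lessThan_atLeast0)
  show ?thesis
    by (subst expectation_chatterjee_xi(1)[OF \<psi>, where T = "\<lambda>s. snd (snd s)" and I = "\<lambda>s. fst (snd s)"])
      (use draws_nonempty[OF kn] in \<open>simp add: integral_aux_law[OF kn, of "\<lambda>js t. expectation (\<lambda>\<omega>. \<psi> (a * (chatterjee_xi c t (resample D js \<omega>) - e)))"] same\<close>)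
qed

text \<open>The freezing lemma averages over draws and tie-breakers with the data fixed; uniformity
  of the draws turns this into a complete U-statistic of order \<open>k\<close> over ordered index
  lists.\<close>

lemma real_cond_exp_xi_resample:
  "AE \<omega> in M. real_cond_exp M (sample_algebra M D n)
      (\<lambda>\<omega>. chatterjee_xi c (snd (snd (S \<omega>))) (resample D (fst (snd (S \<omega>))) \<omega>)) \<omega>
    = (\<Sum>js\<in>draws k n. mean_xi c (pmf_of_set (permutations_of_set {..<k})) (resample D js \<omega>)) / card (draws k n)"
proof -
  text \<open>
    Indices outside of \<open>{..<n}\<close> do not occur almost surely, but they are not excluded; they are
    removed since the corresponding observations are not measurable with respect to the sample.
  \<close>
  define I where "I s = filter (\<lambda>j. j < n) (fst (snd s))" for s :: "nat list \<times> nat list \<times> nat list"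
  have I: "I s = fst (snd s)" if "s \<in> set_pmf (aux_law k n)" for s
  proof -
    have "fst (snd s) \<in> draws k n" using that kn by (auto simp: aux_law_def)
    then show ?thesis unfolding I_def by (subst filter_id_conv) (auto simp: draws_def)
  qed
  have "AE s in distr M (count_space UNIV) S. s \<in> set_pmf (aux_law k n)"
    unfolding S_law by (rule AE_measure_pmf)
  then have supp: "AE \<omega> in M. S \<omega> \<in> set_pmf (aux_law k n)" by (rule AE_distrD[OF S])
  let ?g = "\<lambda>T I \<omega>. chatterjee_xi c (T (S \<omega>)) (resample D (I (S \<omega>)) \<omega>)"
  have m: "(\<lambda>\<omega>. chatterjee_xi c (snd (snd s)) (resample D (I s) \<omega>)) \<in> borel_measurable (sample_algebra M D n)" for s
    unfolding resample_def by (rule measurable_chatterjee_xi) (auto simp: I_def intro: measurable_sample_algebra)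
  have "subalgebra M (seq_algebra M D)"
    using S_indep unfolding indep_set_def indep_sets_def subalgebra_def by (auto split: bool.splits)
  then have sub: "subalgebra M (sample_algebra M D n)"
    using subalgebra_sample_algebra[of M D n] by (auto simp: subalgebra_def)
  interpret F: finite_measure_subalgebra M "sample_algebra M D n" using sub by unfold_locales
  have meas: "?g T I \<in> borel_measurable M" for T :: "_ \<Rightarrow> nat list" and I
    by (rule measurable_compose_countable[OF _ S]) simp
  have ae1: "AE \<omega> in M. real_cond_exp M (sample_algebra M D n) (?g (\<lambda>s. snd (snd s)) (\<lambda>s. fst (snd s))) \<omega>
      = real_cond_exp M (sample_algebra M D n) (?g (\<lambda>s. snd (snd s)) I) \<omega>"
    using supp by (intro F.real_cond_exp_cong meas) (auto simp: I)
  have ae2: "AE \<omega> in M. real_cond_exp M (sample_algebra M D n) (?g (\<lambda>s. snd (snd s)) I) \<omega>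
      = (\<integral>s. chatterjee_xi c (snd (snd s)) (resample D (I s) \<omega>) \<partial>measure_pmf (aux_law k n))"
    by (rule real_cond_exp_indep_pmf[OF S S_law finite_set_pmf_aux_law[OF kn] space_seq_algebra S_indep
          subalgebra_sample_algebra m chatterjee_xi_resample_bound])
  have eq: "(\<integral>s. chatterjee_xi c (snd (snd s)) (resample D (I s) \<omega>) \<partial>measure_pmf (aux_law k n))
      = (\<Sum>js\<in>draws k n. mean_xi c (pmf_of_set (permutations_of_set {..<k})) (resample D js \<omega>)) / card (draws k n)" for \<omega>
  proof -
    have "(\<integral>s. chatterjee_xi c (snd (snd s)) (resample D (I s) \<omega>) \<partial>measure_pmf (aux_law k n))
        = (\<integral>s. chatterjee_xi c (snd (snd s)) (resample D (fst (snd s)) \<omega>) \<partial>measure_pmf (aux_law k n))"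
      by (rule integral_cong_AE) (auto simp: AE_measure_pmf_iff I)
    then show ?thesis
      using integral_aux_law[OF kn, of "\<lambda>js t. chatterjee_xi c t (resample D js \<omega>)"] by (simp only: mean_xi_def)
  qed
  show ?thesis
    using ae1 ae2 unfolding eq by eventually_elim simp
qed

end

subsection \<open>Convergence of the bootstrap statistic\<close>

lemma integral_normal_density_scale:
  fixes f :: "real \<Rightarrow> real"
  assumes [measurable]: "f \<in> borel_measurable borel" and \<sigma>: "\<sigma> > 0"
  shows "(\<integral>x. f x \<partial>density lborel (normal_density 0 \<sigma>)) = (\<integral>z. f (\<sigma> * z) \<partial>density lborel std_normal_density)"
proof -
  have eq: "\<sigma> * normal_density 0 \<sigma> (\<sigma> * z) = std_normal_density z" for z
    using \<sigma> by (simp add: normal_density_def power_mult_distrib real_sqrt_mult)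
  have "(\<integral>x. f x \<partial>density lborel (normal_density 0 \<sigma>)) = (\<integral>x. normal_density 0 \<sigma> x * f x \<partial>lborel)"
    by (subst integral_density) auto
  also have "\<dots> = \<sigma> * (\<integral>z. normal_density 0 \<sigma> (\<sigma> * z) * f (\<sigma> * z) \<partial>lborel)"
    using \<sigma> by (subst lborel_integral_real_affine[where c = \<sigma> and t = 0]) auto
  also have "\<dots> = (\<integral>z. \<sigma> * normal_density 0 \<sigma> (\<sigma> * z) * f (\<sigma> * z) \<partial>lborel)"
    by (simp add: mult.assoc)
  also have "\<dots> = (\<integral>z. f (\<sigma> * z) \<partial>density lborel std_normal_density)"
    unfolding eq by (subst integral_density) auto
  finally show ?thesis .
qed

lemma integrable_square_normal_density:
  "\<sigma> > 0 \<Longrightarrow> integrable (density lborel (normal_density 0 \<sigma>)) (\<lambda>x. x\<^sup>2)"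
  using integrable_normal_moment[of \<sigma> 0 2] by (subst integrable_density) auto

text \<open>A threshold \<open>K\<close> for the square is the threshold \<open>sqrt K\<close> for
  the modulus. The supremum over \<open>n\<close> makes one threshold serve the whole
  sequence.\<close>

lemma uniformly_square_integrable_tail:
  assumes usi: "uniformly_square_integrable M Z" and int: "\<And>n. integrable M (\<lambda>\<omega>. (Z n \<omega>)\<^sup>2)"
    and meas [measurable]: "\<And>n. Z n \<in> borel_measurable M" and e: "e > 0"
  shows "\<exists>L\<ge>0. \<forall>n. (\<integral>\<omega>. (Z n \<omega>)\<^sup>2 * indicator {x. \<bar>x\<bar> > L} (Z n \<omega>) \<partial>M) \<le> e"
proof -
  let ?s = "\<lambda>K. SUP n. \<integral>\<^sup>+\<omega>. ennreal \<bar>(Z n \<omega>)\<^sup>2\<bar> * indicator {\<omega>. \<bar>(Z n \<omega>)\<^sup>2\<bar> > K} \<omega> \<partial>M"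
  have "(?s \<longlongrightarrow> 0) at_top"
    using usi unfolding uniformly_square_integrable_def uniformly_integrable_def by blast
  then have "\<forall>\<^sub>F K in at_top. ?s K < ennreal e" using e by (intro order_tendstoD) auto
  then have "\<forall>\<^sub>F K in at_top. 0 \<le> K \<and> ?s K < ennreal e"
    using eventually_ge_at_top[of "0 :: real"] by eventually_elim simp
  then obtain K where K: "0 \<le> K" "?s K < ennreal e"
    using eventually_happens'[OF trivial_limit_at_top_linorder] by blast
  have "(\<integral>\<omega>. (Z n \<omega>)\<^sup>2 * indicator {x. \<bar>x\<bar> > sqrt K} (Z n \<omega>) \<partial>M) \<le> e" for n
  proof -
    let ?f = "\<lambda>\<omega>. (Z n \<omega>)\<^sup>2 * indicator {x. \<bar>x\<bar> > sqrt K} (Z n \<omega>) :: real"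
    have f: "integrable M ?f"
      by (rule Bochner_Integration.integrable_bound[OF int[of n]]) (auto simp: indicator_def)
    have iff: "\<bar>z\<^sup>2\<bar> > K \<longleftrightarrow> \<bar>z\<bar> > sqrt K" for z :: real
      using real_sqrt_less_iff[of K "z\<^sup>2"] by simp
    have "ennreal (\<integral>\<omega>. ?f \<omega> \<partial>M) = (\<integral>\<^sup>+\<omega>. ennreal (?f \<omega>) \<partial>M)"
      by (rule nn_integral_eq_integral[OF f, symmetric]) simp
    also have "\<dots> = (\<integral>\<^sup>+\<omega>. ennreal \<bar>(Z n \<omega>)\<^sup>2\<bar> * indicator {\<omega>. \<bar>(Z n \<omega>)\<^sup>2\<bar> > K} \<omega> \<partial>M)"
      by (rule nn_integral_cong) (use iff in \<open>auto simp: indicator_def\<close>)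
    also have "\<dots> \<le> ?s K" by (rule SUP_upper) simp
    also note K(2)
    finally show ?thesis using e by (simp add: ennreal_less_iff)
  qed
  then show ?thesis using K(1) by (intro exI[of _ "sqrt K"]) simp
qed

lemma ratio_tendsto_0:
  fixes m :: "nat \<Rightarrow> nat"
  assumes "(\<lambda>n. real (m n)) \<in> o(\<lambda>n. sqrt (real n)) \<or> (\<lambda>n. real (m n)) \<in> o(\<lambda>n. real n)"
  shows "(\<lambda>n. real (m n) / real n) \<longlonglongrightarrow> 0"
proof -
  have "(\<lambda>n. sqrt (real n)) \<in> O(\<lambda>n. real n)"
  proof (rule landau_o.bigI[of 1])
    show "\<forall>\<^sub>F n in sequentially. norm (sqrt (real n)) \<le> 1 * norm (real n)"
      using eventually_ge_at_top[of 1] by eventually_elim (auto intro!: real_le_lsqrt self_le_power simp flip: of_nat_power)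
  qed simp
  then have "(\<lambda>n. real (m n)) \<in> o(\<lambda>n. real n)"
    using assms landau_o.small_big_trans by blast
  then show ?thesis by (rule smalloD_tendsto)
qed

text \<open>Rounding down costs at most a factor 2: the remainder is below \<open>m\<close>, and
  \<open>m\<close> is at most \<open>m * (n div m)\<close> since the quotient is at least 1.\<close>

lemma inverse_div_le:
  fixes m n :: nat
  assumes "0 < m" "m \<le> n"
  shows "1 / real (n div m) \<le> 2 * real m / real n"
proof -
  have q: "1 \<le> n div m" using assms by (simp add: div_greater_zero_iff Suc_le_eq)
  have "n = m * (n div m) + n mod m" by simp
  also have "\<dots> \<le> m * (n div m) + m" using assms by (intro add_mono) (auto intro: less_imp_le)
  also have "\<dots> \<le> m * (n div m) + m * (n div m)" using mult_le_mono2[OF q, of m] by simp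
  finally have "real n \<le> real (2 * (m * (n div m)))" by (simp only: of_nat_le_iff)
  then have "real n \<le> 2 * real m * real (n div m)" by simp
  then show ?thesis using assms q by (simp add: field_simps)
qed

theorem corollary1:
  fixes M :: "'a measure"
    and X Y :: "'a \<Rightarrow> real"
    and D :: "nat \<Rightarrow> 'a \<Rightarrow> real \<times> real"
    and \<tau> J \<tau>' :: "nat \<Rightarrow> 'a \<Rightarrow> nat list"
    and m :: "nat \<Rightarrow> nat"
    and c \<sigma> C :: real
    and f :: "real \<Rightarrow> real"
  assumes "prob_space M"
    and "X \<in> borel_measurable M" and "Y \<in> borel_measurable M"
    and iid: "prob_space.indep_vars M (\<lambda>_. borel) D UNIV"
      "\<And>k. distr M borel (D k) = distr M borel (\<lambda>\<omega>. (X \<omega>, Y \<omega>))"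
    and m: "\<And>n. 0 < n \<Longrightarrow> m n < n" "filterlim m at_top at_top"
    and aux_measurable:
      "\<And>n. 0 < n \<Longrightarrow> (\<lambda>\<omega>. (\<tau> n \<omega>, J n \<omega>, \<tau>' n \<omega>)) \<in> measurable M (count_space UNIV)"
    and aux_distr:
      "\<And>n. 0 < n \<Longrightarrow>
        distr M (count_space UNIV) (\<lambda>\<omega>. (\<tau> n \<omega>, J n \<omega>, \<tau>' n \<omega>)) = measure_pmf (aux_law (m n) n)"
    and aux_indep:
      "\<And>n. 0 < n \<Longrightarrow>
        prob_space.indep_set M (sets (seq_algebra M D))
          (sets (vimage_algebra (space M) (\<lambda>\<omega>. (\<tau> n \<omega>, J n \<omega>, \<tau>' n \<omega>)) (count_space UNIV)))"
    and c: "-1 \<le> c" "c \<le> 1"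
    and \<sigma>: "\<sigma> > 0"
    and clt:
      "weak_conv_m (\<lambda>n. distr M borel (xi_stat M c D \<tau> n)) (density lborel (normal_density 0 \<sigma>))"
    and cond_i_or_ii:
      "(\<lambda>n. real (m n)) \<in> o(\<lambda>n. sqrt (real n)) \<or>
       (continuous_on UNIV (\<lambda>(x, y). measure M {\<omega> \<in> space M. X \<omega> \<le> x \<and> Y \<omega> \<le> y}) \<and>
        \<not> (\<exists>h \<in> borel_measurable borel. AE \<omega> in M. Y \<omega> = h (X \<omega>)) \<and>
        (\<lambda>n. real (m n)) \<in> o(\<lambda>n. real n))"
    and usi: "uniformly_square_integrable M (xi_stat M c D \<tau>)"
    and f: "continuous_on UNIV f" "C > 0" "\<And>x. \<bar>f x\<bar> \<le> C * (1 + x\<^sup>2)"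
  shows "(\<lambda>n. \<integral>\<omega>. f (xi_boot_stat M c D m J \<tau>' n \<omega>) \<partial>M)
    \<longlonglongrightarrow> (\<integral>z. f (\<sigma> * z) \<partial>density lborel std_normal_density)"
proof -
  let ?\<mu> = "distr M borel (\<lambda>\<omega>. (X \<omega>, Y \<omega>))"
  let ?N = "density lborel (normal_density 0 \<sigma>)"
  interpret prob_space M by fact
  interpret iid_pairs M D ?\<mu> by unfold_locales (use iid in auto)
  \<comment> \<open>The three auxiliary variables are bundled so that their joint law and their
    joint independence of the data can be used at once.\<close>
  define S where "S n \<omega> = (\<tau> n \<omega>, J n \<omega>, \<tau>' n \<omega>)" for n \<omega>
  have Sm: "S n \<in> measurable M (count_space UNIV)" if "0 < n" for n
    using aux_measurable[OF that] by (simp add: S_def[abs_def])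
  have resampling: "resampling M D ?\<mu> (m n) n (S n)" if "0 < n" for n
    by unfold_locales
      (use m(1)[OF that] aux_measurable[OF that] aux_distr[OF that] aux_indep[OF that] in \<open>auto simp: S_def[abs_def]\<close>)
  define p where "p k = pmf_of_set (permutations_of_set {..<k::nat})" for k
  have finp: "finite (set_pmf (p k))" for k unfolding p_def by (rule finite_set_pmf_permutations)
  define e where "e k = expectation (\<lambda>\<omega>. chatterjee_xi c (\<tau> k \<omega>) (sample D k \<omega>))" for k
  define T where "T = xi_stat M c D \<tau>"
  define V where "V n \<omega> = sqrt (real (m n)) * (chatterjee_xi c (\<tau>' n \<omega>) (resample D (J n \<omega>) \<omega>) - e (m n))" for n \<omega>
  \<comment> \<open>An explicit version of the conditional expectation, so that \<open>R\<close> is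
    visibly bounded and measurable; it is identified with \<open>real_cond_exp\<close> only almost
    surely.\<close>
  define U where "U n \<omega> = (\<Sum>js\<in>draws (m n) n. mean_xi c (p (m n)) (resample D js \<omega>)) / card (draws (m n) n)" for n \<omega>
  define R where "R n \<omega> = sqrt (real (m n)) * (U n \<omega> - e (m n))" for n \<omega>
  have T_eq: "T n \<omega> = sqrt (real n) * (chatterjee_xi c (fst (S n \<omega>)) (sample D n \<omega>) - e n)" for n \<omega>
    by (simp add: T_def xi_stat_def S_def e_def)
  have V_eq: "V n \<omega> = sqrt (real (m n)) * (chatterjee_xi c (snd (snd (S n \<omega>))) (resample D (fst (snd (S n \<omega>))) \<omega>) - e (m n))" for n \<omega>
    by (simp add: V_def S_def)

  \<comment> \<open>Measurability of the statistics\<close>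
  have Tm [measurable]: "T n \<in> borel_measurable M" for n
  proof (cases "n = 0")
    case False
    have "(\<lambda>\<omega>. chatterjee_xi c (fst (S n \<omega>)) (resample D [0..<n] \<omega>)) \<in> borel_measurable M"
      by (rule measurable_compose_countable[OF _ Sm]) (use False in auto)
    then show ?thesis unfolding T_eq[abs_def] sample_eq_resample by simp
  qed (simp add: T_eq[abs_def])
  have Vm: "V n \<in> borel_measurable M" if "0 < n" for n
  proof -
    have "(\<lambda>\<omega>. chatterjee_xi c (snd (snd (S n \<omega>))) (resample D (fst (snd (S n \<omega>))) \<omega>)) \<in> borel_measurable M"
      by (rule measurable_compose_countable[OF _ Sm]) (use that in auto)
    then show ?thesis unfolding V_eq[abs_def] by simp
  qed
  have mean_m [measurable]: "(\<lambda>\<omega>. mean_xi c (p k) (resample D js \<omega>)) \<in> borel_measurable M" for k js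
    unfolding mean_xi_def integral_pmf_finite[OF finp] by simp
  have Rm [measurable]: "R n \<in> borel_measurable M" for n
    unfolding R_def[abs_def] U_def by simp

  \<comment> \<open>Comparison of the laws of \<open>T\<close> and \<open>V\<close>\<close>
  have ET: "expectation (\<lambda>\<omega>. \<psi> (T n \<omega>))
      = (\<integral>t. expectation (\<lambda>\<omega>. \<psi> (sqrt (real n) * (chatterjee_xi c t (sample D n \<omega>) - e n))) \<partial>measure_pmf (p n))"
    and intT: "integrable M (\<lambda>\<omega>. \<psi> (T n \<omega>))"
    if "0 < n" "\<psi> \<in> borel_measurable borel" "\<And>x. \<bar>\<psi> x\<bar> \<le> b * (1 + x\<^sup>2)" for n and \<psi> :: "real \<Rightarrow> real" and b
    using resampling.expectation_xi_sample[OF resampling[OF that(1)] that(2,3)] unfolding T_eq p_def by auto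
  \<comment> \<open>Only expectations are compared, since \<open>V n\<close> and
    \<open>T (m n)\<close> are different variables. The auxiliary laws are given at positive
    indices; the right-hand side uses the index \<open>m n\<close>, hence
    \<open>0 < m n\<close>.\<close>
  have EV: "expectation (\<lambda>\<omega>. \<psi> (V n \<omega>)) = expectation (\<lambda>\<omega>. \<psi> (T (m n) \<omega>))"
    if "0 < n" "0 < m n" "\<psi> \<in> borel_measurable borel" "\<And>x. \<bar>\<psi> x\<bar> \<le> b * (1 + x\<^sup>2)" for n and \<psi> :: "real \<Rightarrow> real" and b
    using resampling.expectation_xi_resample[OF resampling[OF that(1)] that(3,4)] ET[OF that(2,3,4)]
    unfolding V_eq p_def by simp
  have T2: "integrable M (\<lambda>\<omega>. (T n \<omega>)\<^sup>2)" for n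
    using intT[of n "\<lambda>x. x\<^sup>2" 1] by (cases "n = 0") (auto simp: T_eq)
  have V2: "integrable M (\<lambda>\<omega>. (V n \<omega>)\<^sup>2)" if "0 < n" for n
    using resampling.expectation_chatterjee_xi(2)[OF resampling[OF that], of "\<lambda>x. x\<^sup>2" 1 "sqrt (real (m n))" c
      "\<lambda>s. snd (snd s)" "\<lambda>s. fst (snd s)" "e (m n)"] unfolding V_eq by simp

  \<comment> \<open>Second moments of \<open>T\<close> and \<open>R\<close>\<close>
  have tail: "\<exists>L\<ge>0. \<forall>n. expectation (\<lambda>\<omega>. (T n \<omega>)\<^sup>2 * indicator {x. \<bar>x\<bar> > L} (T n \<omega>)) \<le> d" if "d > 0" for d
    using uniformly_square_integrable_tail[OF _ T2 Tm that] usi by (simp add: T_def)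
  obtain L where L: "0 \<le> L" "\<And>n. expectation (\<lambda>\<omega>. (T n \<omega>)\<^sup>2 * indicator {x. \<bar>x\<bar> > L} (T n \<omega>)) \<le> 1"
    using tail[of 1] by auto
  \<comment> \<open>Up to \<open>L\<close> the square is at most \<open>L^2\<close>; beyond it the
    tail bound with value 1 applies.\<close>
  have ET2: "expectation (\<lambda>\<omega>. (T n \<omega>)\<^sup>2) \<le> L\<^sup>2 + 1" for n
  proof -
    let ?I = "\<lambda>\<omega>. (T n \<omega>)\<^sup>2 * indicator {x. \<bar>x\<bar> > L} (T n \<omega>) :: real"
    have I: "integrable M ?I"
      by (rule Bochner_Integration.integrable_bound[OF T2[of n]]) (auto simp: indicator_def)
    have "expectation (\<lambda>\<omega>. (T n \<omega>)\<^sup>2) \<le> expectation (\<lambda>\<omega>. L\<^sup>2 + ?I \<omega>)"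
    proof (rule integral_mono)
      fix \<omega> show "(T n \<omega>)\<^sup>2 \<le> L\<^sup>2 + ?I \<omega>"
        using L(1) abs_le_square_iff[of "T n \<omega>" L] by (auto simp: indicator_def)
    qed (use T2 I in auto)
    also have "\<dots> = L\<^sup>2 + expectation ?I" using I by (simp add: prob_space)
    finally show ?thesis using L(2)[of n] by simp
  qed

  \<comment> \<open>The centre of \<open>T\<close> is also the mean of the kernel
    \<open>mean_xi\<close>; this is what centres the U-statistic in \<open>R\<close>.\<close>
  have e_eq: "e k = expectation (\<lambda>\<omega>. mean_xi c (p k) (sample D k \<omega>))" if "0 < k" for k
  proof -
    \<comment> \<open>Quadratic growth of the identity, from the nonnegativity of the square of
      \<open>\<bar>x\<bar> - 1\<close>.\<close>
    have "\<bar>x\<bar> \<le> 1 * (1 + x\<^sup>2)" for x :: real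
      using zero_le_power2[of "\<bar>x\<bar> - 1"] by (simp add: power2_eq_square algebra_simps)
    then have "e k = (\<integral>t. expectation (\<lambda>\<omega>. chatterjee_xi c t (sample D k \<omega>)) \<partial>measure_pmf (p k))"
      using resampling.expectation_xi_sample(1)[OF resampling[OF that], of "\<lambda>x. x" 1 1 c k 0]
      by (simp add: e_def S_def p_def)
    also have "\<dots> = expectation (\<lambda>\<omega>. mean_xi c (p k) (sample D k \<omega>))"
      unfolding mean_xi_def integral_pmf_finite[OF finp] sample_eq_resample
      by (subst Bochner_Integration.integral_sum) (auto intro: integrable_chatterjee_xi)
    finally show ?thesis .
  qed

  have R2: "integrable M (\<lambda>\<omega>. (R n \<omega>)\<^sup>2)" for n
  proof -
    obtain b where b: "\<And>js \<omega>. js \<in> draws (m n) n \<Longrightarrow> \<bar>mean_xi c (p (m n)) (resample D js \<omega>)\<bar> \<le> b js"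
    proof
      fix js \<omega>
      have "\<bar>mean_xi c (p (m n)) (resample D js \<omega>)\<bar> \<le> (\<Sum>t\<in>set_pmf (p (m n)). \<bar>pmf (p (m n)) t * chatterjee_xi c t (resample D js \<omega>)\<bar>)"
        unfolding mean_xi_def integral_pmf_finite[OF finp] by (rule sum_abs)
      also have "\<dots> \<le> (\<Sum>t\<in>set_pmf (p (m n)). pmf (p (m n)) t * xi_bound c t js)"
        by (intro sum_mono) (auto simp: abs_mult intro!: mult_left_mono chatterjee_xi_resample_bound)
      finally show "\<bar>mean_xi c (p (m n)) (resample D js \<omega>)\<bar> \<le> (\<Sum>t\<in>set_pmf (p (m n)). pmf (p (m n)) t * xi_bound c t js)" .
    qed
    define B where "B = sqrt (real (m n)) * ((\<Sum>js\<in>draws (m n) n. b js) / card (draws (m n) n) + \<bar>e (m n)\<bar>)"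
    have RB: "\<bar>R n \<omega>\<bar> \<le> B" for \<omega>
    proof -
      have "\<bar>U n \<omega>\<bar> \<le> (\<Sum>js\<in>draws (m n) n. b js) / card (draws (m n) n)"
        unfolding U_def abs_divide abs_of_nat
        by (intro divide_right_mono order_trans[OF sum_abs] sum_mono b) auto
      then have "\<bar>U n \<omega> - e (m n)\<bar> \<le> (\<Sum>js\<in>draws (m n) n. b js) / card (draws (m n) n) + \<bar>e (m n)\<bar>" by linarith
      then show ?thesis unfolding R_def B_def by (simp add: abs_mult mult_left_mono)
    qed
    show ?thesis
    proof (rule integrable_const_bound[where B = "B\<^sup>2"])
      show "AE \<omega> in M. norm ((R n \<omega>)\<^sup>2) \<le> B\<^sup>2"
      proof (rule AE_I2)
        fix \<omega>
        have "\<bar>R n \<omega>\<bar> \<le> \<bar>B\<bar>" using RB[of \<omega>] by linarith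
        then show "norm ((R n \<omega>)\<^sup>2) \<le> B\<^sup>2" by (simp add: abs_le_square_iff)
      qed
    qed simp
  qed

  have ER2: "expectation (\<lambda>\<omega>. (R n \<omega>)\<^sup>2) \<le> (L\<^sup>2 + 1) * (2 * real (m n) / real n)" if n: "0 < n" "0 < m n" for n
  proof -
    let ?k = "m n"
    have le: "?k \<le> n" using m(1)[OF n(1)] by simp
    have cpos: "real (card (draws ?k n)) > 0" using draws_nonempty[OF le] by (simp add: card_gt_0_iff)
    have U': "U n \<omega> - e ?k = (\<Sum>js\<in>draws ?k n. mean_xi c (p ?k) (resample D js \<omega>) - e ?k) / card (draws ?k n)" for \<omega>
      using cpos draws_nonempty[OF le] by (simp add: U_def sum_subtractf diff_divide_distrib)
    have "expectation (\<lambda>\<omega>. (R n \<omega>)\<^sup>2) = ?k * expectation (\<lambda>\<omega>. (U n \<omega> - e ?k)\<^sup>2)"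
      by (simp add: R_def power_mult_distrib)
    also have "\<dots> \<le> ?k * ((\<integral>t. expectation (\<lambda>\<omega>. (chatterjee_xi c t (sample D ?k \<omega>) - e ?k)\<^sup>2) \<partial>measure_pmf (p ?k)) / real (n div ?k))"
      unfolding U' by (rule mult_left_mono[OF second_moment_mean_xi[OF n(2) le finp e_eq[OF n(2)]]]) simp
    also have "\<dots> = (\<integral>t. expectation (\<lambda>\<omega>. (sqrt (real ?k) * (chatterjee_xi c t (sample D ?k \<omega>) - e ?k))\<^sup>2) \<partial>measure_pmf (p ?k)) / real (n div ?k)"
      by (simp add: power_mult_distrib)
    also have "\<dots> = expectation (\<lambda>\<omega>. (T ?k \<omega>)\<^sup>2) / real (n div ?k)"
      using ET[OF n(2), of "\<lambda>x. x\<^sup>2" 1] by simp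
    also have "\<dots> \<le> (L\<^sup>2 + 1) * (1 / real (n div ?k))"
      using divide_right_mono[OF ET2[of ?k], of "real (n div ?k)"] by simp
    also have "\<dots> \<le> (L\<^sup>2 + 1) * (2 * real ?k / real n)"
      using n le by (intro mult_left_mono inverse_div_le) auto
    finally show ?thesis .
  qed

  \<comment> \<open>Decomposition of the bootstrap statistic\<close>
  have boot: "expectation (\<lambda>\<omega>. f (xi_boot_stat M c D m J \<tau>' n \<omega>)) = expectation (\<lambda>\<omega>. f (V n \<omega> - R n \<omega>))" if n: "0 < n" for n
  proof (rule integral_cong_AE)
    have [measurable]: "f \<in> borel_measurable borel" using f(1) by (rule borel_measurable_continuous_onI)
    have [measurable]: "V n \<in> borel_measurable M" by (rule Vm[OF n])
    show "(\<lambda>\<omega>. f (V n \<omega> - R n \<omega>)) \<in> borel_measurable M" by simp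
    \<comment> \<open>Exhibits the statistic as a combination of \<open>V n\<close> and a
      conditional expectation, both measurable. An almost sure identity with
      \<open>V n - R n\<close> alone would not give measurability.\<close>
    have "xi_boot_stat M c D m J \<tau>' n = (\<lambda>\<omega>. V n \<omega> + sqrt (real (m n)) * (e (m n)
        - real_cond_exp M (sample_algebra M D n) (\<lambda>\<omega>'. chatterjee_xi c (\<tau>' n \<omega>') (resample D (J n \<omega>') \<omega>')) \<omega>))"
      by (rule ext) (simp add: xi_boot_stat_def V_def algebra_simps)
    then show "(\<lambda>\<omega>. f (xi_boot_stat M c D m J \<tau>' n \<omega>)) \<in> borel_measurable M"
      by simp
    show "AE \<omega> in M. f (xi_boot_stat M c D m J \<tau>' n \<omega>) = f (V n \<omega> - R n \<omega>)"
      using resampling.real_cond_exp_xi_resample[OF resampling[OF n], of c]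
    proof eventually_elim
      case (elim \<omega>)
      then show ?case
        by (simp add: xi_boot_stat_def V_def R_def U_def S_def p_def right_diff_distrib)
    qed
  qed

  \<comment> \<open>Passage to the limit\<close>
  have "\<forall>\<^sub>F n in sequentially. 0 < m n"
    using eventually_compose_filterlim[OF eventually_gt_at_top[of 0] m(2)] by simp
  then have "\<forall>\<^sub>F n in sequentially. 0 < n \<and> 0 < m n"
    using eventually_gt_at_top[of 0] by eventually_elim simp
  \<comment> \<open>Several facts on \<open>V\<close> and \<open>R\<close> hold only at indices with
    \<open>0 < n\<close> or \<open>0 < m n\<close>, while the limit lemma asks for all indices;
    shifting by \<open>n0\<close> reconciles the two and is undone at the end.\<close>
  then obtain n0 where n0: "\<And>n. n \<ge> n0 \<Longrightarrow> 0 < n" "\<And>n. n \<ge> n0 \<Longrightarrow> 0 < m n"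
    unfolding eventually_sequentially by blast
  have N: "prob_space ?N" by (rule prob_space_normal_density[OF \<sigma>])
  have conv: "(\<lambda>n. expectation (\<lambda>\<omega>. g (V (n + n0) \<omega>))) \<longlonglongrightarrow> (\<integral>x. g x \<partial>?N)"
    if g: "continuous_on UNIV g" "\<And>x. \<bar>g x\<bar> \<le> B" for g :: "real \<Rightarrow> real" and B
  proof -
    have gb [measurable]: "g \<in> borel_measurable borel" using g(1) by (rule borel_measurable_continuous_onI)
    have dT: "real_distribution (distr M borel (T n))" for n by (rule real_distribution_distr) (rule Tm)
    have dN: "real_distribution ?N"
      using N by (simp add: real_distribution_def real_distribution_axioms_def)
    have "isCont g x" for x using g(1) by (simp add: continuous_on_eq_continuous_at)
    then have "(\<lambda>n. integral\<^sup>L (distr M borel (T n)) g) \<longlonglongrightarrow> (\<integral>x. g x \<partial>?N)"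
      using g(2) by (intro weak_conv_imp_integral_bdd_continuous_conv[OF dT dN clt[folded T_def]]) auto
    then have "(\<lambda>n. expectation (\<lambda>\<omega>. g (T n \<omega>))) \<longlonglongrightarrow> (\<integral>x. g x \<partial>?N)"
      by (simp add: integral_distr)
    \<comment> \<open>Convergence along all indices passes to the indices \<open>m n\<close>, as
      \<open>m\<close> tends to infinity.\<close>
    then have "(\<lambda>n. expectation (\<lambda>\<omega>. g (T (m n) \<omega>))) \<longlonglongrightarrow> (\<integral>x. g x \<partial>?N)"
      using m(2) by (rule filterlim_compose)
    then have "(\<lambda>n. expectation (\<lambda>\<omega>. g (T (m (n + n0)) \<omega>))) \<longlonglongrightarrow> (\<integral>x. g x \<partial>?N)"
      by (rule LIMSEQ_ignore_initial_segment)
    \<comment> \<open>Recasts boundedness as quadratic growth, the form in which \<open>EV\<close>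
      transfers expectations.\<close>
    moreover have gB: "\<bar>g x\<bar> \<le> B * (1 + x\<^sup>2)" for x
    proof -
      have "0 \<le> B" using g(2)[of x] by linarith
      then show ?thesis using g(2)[of x] mult_left_mono[of 1 "1 + x\<^sup>2" B] by simp
    qed
    have "expectation (\<lambda>\<omega>. g (V (n + n0) \<omega>)) = expectation (\<lambda>\<omega>. g (T (m (n + n0)) \<omega>))" for n
      by (rule EV[OF n0 gb gB]) auto
    ultimately show ?thesis by simp
  qed
  have "(\<lambda>n. expectation (\<lambda>\<omega>. f (V (n + n0) \<omega> - R (n + n0) \<omega>))) \<longlonglongrightarrow> (\<integral>x. f x \<partial>?N)"
  proof (rule tendsto_expectation_quadratic_growth[OF _ _ _ _ conv _ _ N _ _ f])
    show "(\<lambda>n. expectation (\<lambda>\<omega>. (R (n + n0) \<omega>)\<^sup>2)) \<longlonglongrightarrow> 0"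
    proof (rule tendsto_sandwich[OF _ _ tendsto_const])
      have "(\<lambda>n. (L\<^sup>2 + 1) * (2 * (real (m n) / real n))) \<longlonglongrightarrow> (L\<^sup>2 + 1) * (2 * 0)"
        using cond_i_or_ii by (intro tendsto_intros ratio_tendsto_0) auto
      then show "(\<lambda>n. (L\<^sup>2 + 1) * (2 * real (m (n + n0)) / real (n + n0))) \<longlonglongrightarrow> 0"
        by (intro LIMSEQ_ignore_initial_segment[of "\<lambda>n. (L\<^sup>2 + 1) * (2 * real (m n) / real n)"]) simp
      show "\<forall>\<^sub>F n in sequentially. expectation (\<lambda>\<omega>. (R (n + n0) \<omega>)\<^sup>2) \<le> (L\<^sup>2 + 1) * (2 * real (m (n + n0)) / real (n + n0))"
        using ER2[OF n0] by (intro always_eventually allI) (simp del: of_nat_add)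
    qed (simp add: always_eventually)
    show "\<exists>L. \<forall>n. expectation (\<lambda>\<omega>. (V (n + n0) \<omega>)\<^sup>2 * indicator {x. \<bar>x\<bar> > L} (V (n + n0) \<omega>)) \<le> d" if d: "d > 0" for d
    proof -
      obtain L where L: "\<And>n. expectation (\<lambda>\<omega>. (T n \<omega>)\<^sup>2 * indicator {x. \<bar>x\<bar> > L} (T n \<omega>)) \<le> d"
        using tail[OF d] by auto
      \<comment> \<open>The truncated square is an admissible test function, so the tails of
        \<open>V\<close> are those of \<open>T\<close> at \<open>m (n + n0)\<close>, and the
        threshold found for \<open>T\<close> serves all shifted indices.\<close>
      have "expectation (\<lambda>\<omega>. (V (n + n0) \<omega>)\<^sup>2 * indicator {x. \<bar>x\<bar> > L} (V (n + n0) \<omega>))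
          = expectation (\<lambda>\<omega>. (T (m (n + n0)) \<omega>)\<^sup>2 * indicator {x. \<bar>x\<bar> > L} (T (m (n + n0)) \<omega>))" for n
      proof (rule EV)
        show "(\<lambda>x. x\<^sup>2 * indicator {x. \<bar>x\<bar> > L} x) \<in> borel_measurable (borel :: real measure)" by measurable
        show "\<bar>x\<^sup>2 * indicator {x. \<bar>x\<bar> > L} x\<bar> \<le> 1 * (1 + x\<^sup>2)" for x :: real by (simp add: indicator_def)
      qed (simp_all add: n0)
      then show ?thesis using L by (intro exI[of _ L] allI) (simp only:)
    qed
  qed (use Vm V2 R2 n0 \<sigma> in \<open>auto intro: integrable_square_normal_density\<close>)
  then have "(\<lambda>n. expectation (\<lambda>\<omega>. f (xi_boot_stat M c D m J \<tau>' (n + n0) \<omega>))) \<longlonglongrightarrow> (\<integral>x. f x \<partial>?N)"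
    using boot[OF n0(1)] by simp
  then have "(\<lambda>n. expectation (\<lambda>\<omega>. f (xi_boot_stat M c D m J \<tau>' n \<omega>))) \<longlonglongrightarrow> (\<integral>x. f x \<partial>?N)"
    by (rule LIMSEQ_offset)
  then show ?thesis
    using integral_normal_density_scale[OF borel_measurable_continuous_onI[OF f(1)] \<sigma>] by simp
qed

end
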